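(* Let $(X,\mathcal{B},\mu,T)$ be an aperiodic ergodic measure preserving system with zero entropy. Then for a generic set of measurable subsets $A\subset X$ the partition $\{A,X\setminus A\}$ is a generator.
   Context: $(X,\mathcal{B},\mu)$ is a standard probability space and $T$ is an invertible, $\mu$-preserving, ergodic transformation; aperiodic means that the set of $T$-periodic points is null. The space of measurable subsets (modulo null sets) is a complete separable metric space under $d(A,A')=\mu(A\triangle A')$; a generic set is one containing a dense $G_\delta$ subset of this space. A finite partition $\mathcal{P}$ is a generator if $\bigvee_{n\in\mathbb{Z}}T^{-n}\mathcal{P}=\mathcal{B}$ modulo null sets. *)

theory Defs
  imports "HOL-Probability.Probability"
begin

section \<open>Measure preserving systems\<close>

text \<open>
  A Polish space with a Borel probability measure, where the \<sigma>-algebra may be the Borel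
  \<sigma>-algebra, its completion, or anything in between, so that both usual conventions (standard
  Borel spaces and complete Lebesgue spaces) are covered.
\<close>
definition standard_probability_space :: "'a measure \<Rightarrow> bool" where
  "standard_probability_space M \<longleftrightarrow>
     prob_space M \<and>
     (\<exists>X. completely_metrizable_space X \<and> second_countable X \<and> topspace X = space M \<and>
          sigma_sets (space M) {U. openin X U} \<subseteq> sets M \<and>
          (\<forall>A\<in>sets M. \<exists>B\<in>sigma_sets (space M) {U. openin X U}.
                       \<exists>C\<in>sigma_sets (space M) {U. openin X U}.
             B \<subseteq> A \<and> A \<subseteq> C \<and> measure M (C - B) = 0))"

definition invertible_measure_preserving :: "'a measure \<Rightarrow> ('a \<Rightarrow> 'a) \<Rightarrow> bool" where
  "invertible_measure_preserving M T \<longleftrightarrow>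
     bij_betw T (space M) (space M) \<and> T \<in> measurable M M \<and>
     the_inv_into (space M) T \<in> measurable M M \<and> distr M M T = M"

definition ergodic :: "'a measure \<Rightarrow> ('a \<Rightarrow> 'a) \<Rightarrow> bool" where
  "ergodic M T \<longleftrightarrow>
     (\<forall>A\<in>sets M. T -` A \<inter> space M = A \<longrightarrow> measure M A = 0 \<or> measure M A = 1)"

definition aperiodic :: "'a measure \<Rightarrow> ('a \<Rightarrow> 'a) \<Rightarrow> bool" where
  "aperiodic M T \<longleftrightarrow> {x \<in> space M. \<exists>n>0. (T ^^ n) x = x} \<in> null_sets M"

definition int_iterate :: "'a measure \<Rightarrow> ('a \<Rightarrow> 'a) \<Rightarrow> int \<Rightarrow> 'a \<Rightarrow> 'a" where
  "int_iterate M T k = (if 0 \<le> k then T ^^ nat k else the_inv_into (space M) T ^^ nat (- k))"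


section \<open>Partitions, entropy and generators\<close>

text \<open>Empty cells are allowed, so that \<open>{A, space M - A}\<close> is a partition for every measurable \<open>A\<close>.\<close>
definition finite_partition :: "'a measure \<Rightarrow> 'a set set \<Rightarrow> bool" where
  "finite_partition M P \<longleftrightarrow> finite P \<and> P \<subseteq> sets M \<and> disjoint P \<and> \<Union>P = space M"

definition partition_vimage :: "'a measure \<Rightarrow> ('a \<Rightarrow> 'a) \<Rightarrow> 'a set set \<Rightarrow> 'a set set" where
  "partition_vimage M S P = (\<lambda>A. S -` A \<inter> space M) ` P"

definition partition_join :: "'a set set \<Rightarrow> 'a set set \<Rightarrow> 'a set set" where
  "partition_join P Q = {A \<inter> B | A B. A \<in> P \<and> B \<in> Q}"

text \<open>The join of \<open>T\<^sup>-\<^sup>i P\<close> over \<open>i < n\<close>.\<close>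
primrec iterated_join :: "'a measure \<Rightarrow> ('a \<Rightarrow> 'a) \<Rightarrow> 'a set set \<Rightarrow> nat \<Rightarrow> 'a set set" where
  "iterated_join M T P 0 = {space M}"
| "iterated_join M T P (Suc n) =
     partition_join (iterated_join M T P n) (partition_vimage M (T ^^ n) P)"

text \<open>Since \<open>ln 0 = 0\<close>, null cells contribute nothing.\<close>
definition partition_entropy :: "'a measure \<Rightarrow> 'a set set \<Rightarrow> real" where
  "partition_entropy M P = - (\<Sum>A\<in>P. measure M A * ln (measure M A))"

definition entropy_wrt_partition :: "'a measure \<Rightarrow> ('a \<Rightarrow> 'a) \<Rightarrow> 'a set set \<Rightarrow> real" where
  "entropy_wrt_partition M T P =
     lim (\<lambda>n. partition_entropy M (iterated_join M T P n) / real n)"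

definition ks_entropy :: "'a measure \<Rightarrow> ('a \<Rightarrow> 'a) \<Rightarrow> ereal" where
  "ks_entropy M T = (SUP P\<in>{P. finite_partition M P}. ereal (entropy_wrt_partition M T P))"

text \<open>
  For a bimeasurable \<open>T\<close> the generated \<sigma>-algebra is contained in \<open>sets M\<close>; hence equality modulo
  null sets only requires that every measurable set agrees, modulo a null set, with a generated one.
\<close>
definition generator :: "'a measure \<Rightarrow> ('a \<Rightarrow> 'a) \<Rightarrow> 'a set set \<Rightarrow> bool" where
  "generator M T P \<longleftrightarrow>
     finite_partition M P \<and>
     (\<forall>B\<in>sets M. \<exists>C\<in>sigma_sets (space M) (\<Union>n::int. partition_vimage M (int_iterate M T n) P).
        measure M (sym_diff B C) = 0)"


section \<open>The space of measurable sets modulo null sets\<close>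

definition null_equiv :: "'a measure \<Rightarrow> ('a set \<times> 'a set) set" where
  "null_equiv M = {(A, B). A \<in> sets M \<and> B \<in> sets M \<and> measure M (sym_diff A B) = 0}"

definition measure_algebra :: "'a measure \<Rightarrow> 'a set set set" where
  "measure_algebra M = sets M // null_equiv M"

text \<open>
  The distance does not depend on the chosen representatives
  (lemma \<open>measure_algebra_dist_class\<close> below).
\<close>
definition measure_algebra_dist :: "'a measure \<Rightarrow> 'a set set \<Rightarrow> 'a set set \<Rightarrow> real" where
  "measure_algebra_dist M a b = measure M (sym_diff (SOME A. A \<in> a) (SOME B. B \<in> b))"

definition measure_algebra_topology :: "'a measure \<Rightarrow> 'a set set topology" where
  "measure_algebra_topology M =
     Metric_space.mtopology (measure_algebra M) (measure_algebra_dist M)"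

definition generic_in :: "'b topology \<Rightarrow> 'b set \<Rightarrow> bool" where
  "generic_in X S \<longleftrightarrow> (\<exists>G. gdelta_in X G \<and> X closure_of G = topspace X \<and> G \<subseteq> S)"

lemma (in finite_measure) measure_sym_diff_triangle:
  assumes "A \<in> sets M" "B \<in> sets M" "C \<in> sets M"
  shows "measure M (sym_diff A C) \<le> measure M (sym_diff A B) + measure M (sym_diff B C)"
proof -
  have "measure M (sym_diff A C) \<le> measure M (sym_diff A B \<union> sym_diff B C)"
    using assms by (intro finite_measure_mono) auto
  also have "\<dots> \<le> measure M (sym_diff A B) + measure M (sym_diff B C)"
    using assms by (intro measure_Un_le) auto
  finally show ?thesis .
qed

lemma (in finite_measure) equiv_null_equiv: "equiv (sets M) (null_equiv M)"
proof (rule equivI)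
  show "null_equiv M \<subseteq> sets M \<times> sets M"
    by (auto simp: null_equiv_def)
  show "refl_on (sets M) (null_equiv M)"
    by (auto simp: refl_on_def null_equiv_def)
  show "sym (null_equiv M)"
    by (auto simp: sym_def null_equiv_def Un_commute)
  show "trans (null_equiv M)"
  proof (rule transI)
    fix A B C assume "(A, B) \<in> null_equiv M" "(B, C) \<in> null_equiv M"
    then show "(A, C) \<in> null_equiv M"
      using measure_sym_diff_triangle[of A B C] measure_nonneg[of M "sym_diff A C"]
      by (auto simp: null_equiv_def simp del: measure_nonneg)
  qed
qed

lemma (in finite_measure) measure_algebra_dist_class:
  assumes "a \<in> measure_algebra M" "b \<in> measure_algebra M" "A \<in> a" "B \<in> b"
  shows "measure_algebra_dist M a b = measure M (sym_diff A B)"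
proof -
  define A' B' where "A' = (SOME A. A \<in> a)" and "B' = (SOME B. B \<in> b)"
  have "A' \<in> a" "B' \<in> b"
    using assms(3,4) by (auto simp: A'_def B'_def intro: someI)
  then have "(A, A') \<in> null_equiv M" "(B, B') \<in> null_equiv M"
    using assms quotient_eq_iff[OF equiv_null_equiv] unfolding measure_algebra_def by blast+
  then have *: "A \<in> sets M" "A' \<in> sets M" "B \<in> sets M" "B' \<in> sets M"
    "measure M (sym_diff A A') = 0" "measure M (sym_diff B B') = 0"
    by (auto simp: null_equiv_def)
  have sym: "sym_diff A' A = sym_diff A A'" "sym_diff B' B = sym_diff B B'" by auto
  have "measure M (sym_diff A B) = measure M (sym_diff A' B')"
    using measure_sym_diff_triangle[of A A' B] measure_sym_diff_triangle[of A' B' B]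
      measure_sym_diff_triangle[of A' A B'] measure_sym_diff_triangle[of A B B'] *
    unfolding sym by linarith
  then show ?thesis by (simp add: measure_algebra_dist_def A'_def B'_def)
qed

lemma (in finite_measure) Metric_space_measure_algebra:
  "Metric_space (measure_algebra M) (measure_algebra_dist M)"
proof
  fix a b :: "'a set set"
  show "0 \<le> measure_algebra_dist M a b"
    by (simp add: measure_algebra_dist_def)
  show "measure_algebra_dist M a b = measure_algebra_dist M b a"
    by (simp add: measure_algebra_dist_def Un_commute)
next
  fix a b assume ab: "a \<in> measure_algebra M" "b \<in> measure_algebra M"
  then obtain A B where AB: "A \<in> a" "B \<in> b"
    using in_quotient_imp_non_empty[OF equiv_null_equiv] unfolding measure_algebra_def by blast
  then have "A \<in> sets M" "B \<in> sets M"
    using ab in_quotient_imp_subset[OF equiv_null_equiv] unfolding measure_algebra_def by blast+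
  then have "measure M (sym_diff A B) = 0 \<longleftrightarrow> (A, B) \<in> null_equiv M"
    by (simp add: null_equiv_def)
  also have "\<dots> \<longleftrightarrow> a = b"
    using quotient_eq_iff[OF equiv_null_equiv] ab AB unfolding measure_algebra_def by metis
  finally show "measure_algebra_dist M a b = 0 \<longleftrightarrow> a = b"
    using measure_algebra_dist_class[OF ab AB] by simp
next
  fix a b c assume abc: "a \<in> measure_algebra M" "b \<in> measure_algebra M" "c \<in> measure_algebra M"
  have "\<exists>A\<in>x. A \<in> sets M" if "x \<in> measure_algebra M" for x
    using that in_quotient_imp_non_empty[OF equiv_null_equiv]
      in_quotient_imp_subset[OF equiv_null_equiv]
    unfolding measure_algebra_def by blast
  then obtain A B C where ABC: "A \<in> a" "B \<in> b" "C \<in> c"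
      and "A \<in> sets M" "B \<in> sets M" "C \<in> sets M"
    using abc by meson
  then show "measure_algebra_dist M a c \<le> measure_algebra_dist M a b + measure_algebra_dist M b c"
    using abc ABC measure_sym_diff_triangle[of A B C]
    by (simp only: measure_algebra_dist_class)
qed

end

(*
  Zero entropy leaves only subexponentially many likely n-names of a set B. Given any set A0, take a
  Rokhlin tower of height n, change A0 on a small proportion of its levels so that they spell a
  marker for the base followed by a short code word for the B-name of the column: then B is, up to a
  small error, a finite Boolean combination of translates of the new set A. Hence for each B and e
  the sets A whose translates determine B up to e are dense; they are also open, and Baire's theorem,
  applied to B in a countable dense family, gives the generators.
*)
theory Submission
  imports Defs
begin

section \<open>Subadditivity and entropy\<close>

text \<open>Two obstacles shape the coding. The set \<open>A0\<close> is arbitrary and may imitate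
  any marker, so levels outside \<open>A\<close> have to be placed all along each column; they are
  few only if the marker is long. And every column must have a short code word, so the base has to
  consist of points with likely names, which a plain Rokhlin tower does not provide. The tower is
  therefore built with \<open>n\<close> possible offsets; averaging over them, some offset loses no
  more than the measure of the unlikely points when its base is cut down to likely ones.
  Aperiodicity and ergodicity enter through the towers: the former excludes atoms, so that there are
  sets of arbitrarily small positive measure, and the latter makes almost every backward orbit meet
  such a set. By zero entropy, for large \<open>n\<close>, all names outside a set of measure
  \<delta> have probability at least \<open>(1/2) ^ c\<close> with \<open>c\<close> about
  \<open>\<delta> * n\<close>, so \<open>c\<close> bits suffice to tell them apart. The sets of
  encoders are open because a code with a finite window \<open>I\<close> moves by at most
  \<open>card I\<close> times the change of \<open>A\<close>.\<close>

lemma fekete_convergent: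
  fixes f :: "nat \<Rightarrow> real"
  assumes sub: "\<And>m n. f (m + n) \<le> f m + f n" and nonneg: "\<And>n. 0 \<le> f n"
  shows "convergent (\<lambda>n. f n / real n)"
proof -
  define L where "L = (INF n\<in>{0<..}. f n / real n)"
  have bdd: "bdd_below ((\<lambda>n. f n / real n) ` {0<..})"
    using nonneg by (intro bdd_belowI[of _ 0]) auto
  have low: "L \<le> f n / real n" if "n > 0" for n
    unfolding L_def using that bdd by (intro cINF_lower) auto
  have multiple: "f (q * k) \<le> real q * f k" if "q > 0" for q k
    using that
  proof (induction q rule: nat_induct_non_zero)
    case (Suc q)
    then show ?case using sub[of k "q * k"] by (simp add: algebra_simps)
  qed auto
  have "(\<lambda>n. f n / real n) \<longlonglongrightarrow> L"
  proof (rule LIMSEQ_I)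
    fix e :: real assume e: "e > 0"
    have "\<exists>k\<in>{0<..}. f k / real k < L + e / 2"
      unfolding L_def using bdd e
      by (subst cINF_less_iff[symmetric]) (auto intro!: exI[of _ 1])
    then obtain k where k: "k > 0" "f k / real k < L + e / 2" by auto
    define C where "C = Max (f ` {..<k})"
    have C: "f r \<le> C" if "r < k" for r
      unfolding C_def using that by (intro Max_ge) auto
    have C0: "C \<ge> 0" using C[of 0] k nonneg[of 0] by linarith
    \<comment> \<open>Division of \<open>n\<close> by \<open>k\<close>: the quotient blocks cost
      \<open>f k\<close> each, the remainder at most the constant \<open>C\<close>, which disappears
      after division by \<open>n\<close>.\<close>
    have upper: "f n / real n \<le> f k / real k + C / real n" if n: "n \<ge> k" for n
    proof -
      have q: "n div k > 0" using n k by (simp add: div_greater_zero_iff)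
      have "f n \<le> f (n div k * k) + f (n mod k)"
        using sub[of "n div k * k" "n mod k"] by simp
      also have "\<dots> \<le> real (n div k) * f k + C"
        using multiple[OF q, of k] C[of "n mod k"] k by (intro add_mono) auto
      also have "real (n div k) * f k \<le> real n / real k * f k"
        using nonneg[of k] by (intro mult_right_mono of_nat_div_le_of_nat) auto
      finally have "f n \<le> real n / real k * f k + C" by simp
      then show ?thesis using n k by (simp add: field_simps)
    qed
    obtain N :: nat where N: "2 * C / e < real N" using reals_Archimedean2 by blast
    have "norm (f n / real n - L) < e" if n: "n \<ge> max k (Suc N)" for n
    proof -
      have n0: "n > 0" using n by auto
      have "2 * C / e < real n" using N n by linarith
      then have "C / real n < e / 2" using e n0 by (simp add: field_simps)
      then show ?thesis using low[OF n0] upper[of n] k n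
        unfolding real_norm_def abs_less_iff by (intro conjI) linarith+
    qed
    then show "\<exists>N. \<forall>n\<ge>N. norm (f n / real n - L) < e" by blast
  qed
  then show ?thesis by (auto simp: convergent_def)
qed

section \<open>Shannon entropy and the entropy of names\<close>

lemma neg_mult_ln_nonneg: "0 \<le> x \<Longrightarrow> x \<le> 1 \<Longrightarrow> 0 \<le> - (x * ln x)" for x :: real
  by (cases "x = 0") (auto intro!: mult_nonneg_nonpos)

text \<open>The difference of the two sides is the relative entropy of \<open>p\<close> with respect
  to the product of its marginals. Applying \<open>ln t \<le> t - 1\<close> at
  \<open>t = a i * b j / p i j\<close> bounds its negative term by term, and these bounds sum to
  0.\<close>

lemma entropy_joint_le:
  fixes p :: "'i \<Rightarrow> 'j \<Rightarrow> real"
  assumes fin: "finite I" "finite J"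
    and nonneg: "\<And>i j. 0 \<le> p i j"
    and a: "\<And>i. i \<in> I \<Longrightarrow> (\<Sum>j\<in>J. p i j) = a i"
    and b: "\<And>j. j \<in> J \<Longrightarrow> (\<Sum>i\<in>I. p i j) = b j"
    and one: "(\<Sum>i\<in>I. a i) = 1" "(\<Sum>j\<in>J. b j) = 1"
  shows "- (\<Sum>i\<in>I. \<Sum>j\<in>J. p i j * ln (p i j)) \<le> - (\<Sum>i\<in>I. a i * ln (a i)) - (\<Sum>j\<in>J. b j * ln (b j))"
proof -
  have pa: "p i j \<le> a i" and pb: "p i j \<le> b j" if "i \<in> I" "j \<in> J" for i j
    using that fin nonneg a[of i, symmetric] b[of j, symmetric]
    by (auto intro!: member_le_sum[of j J "p i"] member_le_sum[of i I "\<lambda>i. p i j"])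
  have "p i j * ln (a i) + p i j * ln (b j) - p i j * ln (p i j) \<le> a i * b j - p i j"
    if ij: "i \<in> I" "j \<in> J" for i j
  proof (cases "p i j = 0")
    case True
    then show ?thesis using pa[OF ij] pb[OF ij] by simp
  next
    case False
    then have pos: "p i j > 0" "a i > 0" "b j > 0"
      using nonneg[of i j] pa[OF ij] pb[OF ij] by auto
    have "p i j * ln (a i) + p i j * ln (b j) - p i j * ln (p i j) = p i j * ln (a i * b j / p i j)"
      using pos by (simp add: ln_mult ln_div algebra_simps)
    also have "\<dots> \<le> p i j * (a i * b j / p i j - 1)"
      using pos by (intro mult_left_mono ln_le_minus_one) auto
    also have "\<dots> = a i * b j - p i j" using pos by (simp add: field_simps)
    finally show ?thesis .
  qed
  then have "(\<Sum>i\<in>I. \<Sum>j\<in>J. p i j * ln (a i) + p i j * ln (b j) - p i j * ln (p i j))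
      \<le> (\<Sum>i\<in>I. \<Sum>j\<in>J. a i * b j - p i j)"
    by (intro sum_mono) auto
  also have "\<dots> = (\<Sum>i\<in>I. a i) * (\<Sum>j\<in>J. b j) - (\<Sum>i\<in>I. a i)"
    using a by (simp add: sum_subtractf sum_product)
  also have "\<dots> = 0" using one by simp
  finally have *: "(\<Sum>i\<in>I. \<Sum>j\<in>J. p i j * ln (a i) + p i j * ln (b j) - p i j * ln (p i j)) \<le> 0" .
  have "(\<Sum>i\<in>I. \<Sum>j\<in>J. p i j * ln (a i)) = (\<Sum>i\<in>I. a i * ln (a i))"
    using a by (simp add: sum_distrib_right[symmetric])
  moreover have "(\<Sum>i\<in>I. \<Sum>j\<in>J. p i j * ln (b j)) = (\<Sum>j\<in>J. b j * ln (b j))"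
    using b by (subst sum.swap) (simp add: sum_distrib_right[symmetric])
  ultimately show ?thesis
    using * by (simp add: sum_subtractf sum.distrib)
qed

text \<open>With the iterates of both signs in one family \<open>U\<close>, moves up and down a
  column cancel by \<open>action_add\<close>. The two laws are confined to \<open>space M\<close>
  because \<open>the_inv_into\<close> is unspecified elsewhere.\<close>

locale measure_preserving_action = prob_space M for M :: "'a measure" +
  fixes U :: "int \<Rightarrow> 'a \<Rightarrow> 'a"
  assumes measurable_action [measurable]: "U k \<in> measurable M M"
    and action_zero: "x \<in> space M \<Longrightarrow> U 0 x = x"
    and action_add: "x \<in> space M \<Longrightarrow> U a (U b x) = U (a + b) x"
    and measure_action_vimage: "A \<in> sets M \<Longrightarrow> measure M (U k -` A \<inter> space M) = measure M A"
begin

lemma action_in_space: "x \<in> space M \<Longrightarrow> U k x \<in> space M"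
  using measurable_space[OF measurable_action] .

lemma measure_action: "A \<in> sets M \<Longrightarrow> measure M {x \<in> space M. U k x \<in> A} = measure M A"
  using measure_action_vimage[of A k] by (simp add: vimage_def Int_def conj_commute)

text \<open>A binary name is stored as the set of positions of its ones, so that the names of length
  \<open>n\<close> are exactly the members of \<open>Pow {..<n}\<close>.\<close>

definition itinerary :: "'a set \<Rightarrow> nat \<Rightarrow> 'a \<Rightarrow> nat set" where
  "itinerary B n x = {j. j < n \<and> U (int j) x \<in> B}"

definition cylinder :: "'a set \<Rightarrow> nat \<Rightarrow> nat set \<Rightarrow> 'a set" where
  "cylinder B n w = {x \<in> space M. itinerary B n x = w}"

lemma itinerary_subset: "itinerary B n x \<subseteq> {..<n}"
  by (auto simp: itinerary_def)

lemma sets_cylinder [measurable]: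
  assumes [measurable]: "B \<in> sets M"
  shows "cylinder B n w \<in> sets M"
proof (cases "w \<subseteq> {..<n}")
  case True
  then have "cylinder B n w = {x \<in> space M. \<forall>j<n. U (int j) x \<in> B \<longleftrightarrow> j \<in> w}"
    by (auto simp: cylinder_def itinerary_def)
  also have "\<dots> \<in> sets M" by measurable
  finally show ?thesis .
next
  case False
  then have "cylinder B n w = {}" using itinerary_subset by (auto simp: cylinder_def)
  then show ?thesis by simp
qed

lemma disjoint_cylinder: "disjoint_family_on (cylinder B n) W"
  by (auto simp: disjoint_family_on_def cylinder_def)

lemma sum_measure_Int_cylinder:
  assumes [measurable]: "A \<in> sets M" "B \<in> sets M"
  shows "(\<Sum>w\<in>Pow {..<n}. measure M (A \<inter> cylinder B n w)) = measure M A"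
proof -
  have "(\<Sum>w\<in>Pow {..<n}. measure M (A \<inter> cylinder B n w)) =
      measure M (\<Union>w\<in>Pow {..<n}. A \<inter> cylinder B n w)"
    by (intro finite_measure_finite_Union[symmetric])
       (auto intro!: disjoint_family_on_bisimulation[OF disjoint_cylinder])
  also have "(\<Union>w\<in>Pow {..<n}. A \<inter> cylinder B n w) = A"
    using sets.sets_into_space[OF assms(1)] itinerary_subset by (fastforce simp: cylinder_def)
  finally show ?thesis .
qed

lemma sum_measure_cylinder:
  "B \<in> sets M \<Longrightarrow> (\<Sum>w\<in>Pow {..<n}. measure M (cylinder B n w)) = 1"
  using sum_measure_Int_cylinder[of "space M" B n]
  by (simp add: prob_space cylinder_def Int_def conj_commute cong: conj_cong)

definition block_entropy :: "'a set \<Rightarrow> nat \<Rightarrow> real" where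
  "block_entropy B n =
     - (\<Sum>w\<in>Pow {..<n}. measure M (cylinder B n w) * ln (measure M (cylinder B n w)))"

lemma block_entropy_nonneg: "0 \<le> block_entropy B n"
  unfolding block_entropy_def sum_negf[symmetric]
  by (intro sum_nonneg neg_mult_ln_nonneg) auto

text \<open>This is concatenation of words; it turns a sum over names of length \<open>m + n\<close>
  into a double sum.\<close>

lemma bij_betw_Pow_add:
  "bij_betw (\<lambda>(u, v). u \<union> (\<lambda>j. m + j) ` v) (Pow {..<m} \<times> Pow {..<n}) (Pow {..<m + n :: nat})"
proof (rule bij_betw_byWitness[where f' = "\<lambda>w. (w \<inter> {..<m}, {j. m + j \<in> w})"])
  show "\<forall>w\<in>Pow {..<m + n}. (case (w \<inter> {..<m}, {j. m + j \<in> w}) of (u, v) \<Rightarrow> u \<union> (+) m ` v) = w"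
  proof
    fix w assume "w \<in> Pow {..<m + n}"
    have "x \<in> (w \<inter> {..<m}) \<union> (+) m ` {j. m + j \<in> w}" if "x \<in> w" for x
    proof (cases "x < m")
      case False
      then have "x = m + (x - m)" by simp
      then show ?thesis using that by (metis (mono_tags, lifting) UnI2 imageI mem_Collect_eq)
    qed (use that in auto)
    then show "(case (w \<inter> {..<m}, {j. m + j \<in> w}) of (u, v) \<Rightarrow> u \<union> (+) m ` v) = w" by auto
  qed
qed auto

text \<open>The long name of \<open>x\<close> is its \<open>m\<close>-name followed by the
  \<open>n\<close>-name of \<open>U (int m) x\<close>. By invariance the second part is distributed
  like an ordinary \<open>n\<close>-name, so this is subadditivity of entropy for a pair of random
  words.\<close>

lemma block_entropy_add_le:
  assumes [measurable]: "B \<in> sets M"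
  shows "block_entropy B (m + n) \<le> block_entropy B m + block_entropy B n"
proof -
  let ?S = "\<lambda>v. {x \<in> space M. U (int m) x \<in> cylinder B n v}"
  let ?p = "\<lambda>u v. measure M (cylinder B m u \<inter> ?S v)"
  have split: "cylinder B (m + n) (u \<union> (\<lambda>j. m + j) ` v) = cylinder B m u \<inter> ?S v"
    if uv: "u \<in> Pow {..<m}" "v \<in> Pow {..<n}" for u v
  proof -
    have "itinerary B (m + n) x = itinerary B m x \<union> (+) m ` itinerary B n (U (int m) x)"
      if "x \<in> space M" for x
    proof -
      have "j \<in> itinerary B m x \<union> (+) m ` itinerary B n (U (int m) x)"
        if "j \<in> itinerary B (m + n) x" for j
      proof (cases "j < m")
        case False
        then have "j = m + (j - m)" "j - m \<in> itinerary B n (U (int m) x)"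
          using that \<open>x \<in> space M\<close> by (auto simp: itinerary_def action_add of_nat_diff)
        then show ?thesis by blast
      qed (use that in \<open>auto simp: itinerary_def\<close>)
      moreover have "(+) m ` itinerary B n (U (int m) x) \<subseteq> itinerary B (m + n) x"
        using that by (auto simp: itinerary_def action_add add.commute)
      ultimately show ?thesis by (auto simp: itinerary_def)
    qed
    moreover have "itinerary B m x \<union> (+) m ` itinerary B n y = u \<union> (+) m ` v \<longleftrightarrow>
        itinerary B m x = u \<and> itinerary B n y = v" for x y
      using inj_onD[OF bij_betw_imp_inj_on[OF bij_betw_Pow_add[of m n]],
          of "(itinerary B m x, itinerary B n y)" "(u, v)"] uv
        itinerary_subset[of B m x] itinerary_subset[of B n y]
      by auto
    ultimately show ?thesis by (auto simp: cylinder_def action_in_space)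
  qed
  have "block_entropy B (m + n) = 
      - (\<Sum>(u, v)\<in>Pow {..<m} \<times> Pow {..<n}. ?p u v * ln (?p u v))"
    unfolding block_entropy_def
    by (subst sum.reindex_bij_betw[OF bij_betw_Pow_add, symmetric])
       (auto intro!: sum.cong simp: split)
  also have "\<dots> = - (\<Sum>u\<in>Pow {..<m}. \<Sum>v\<in>Pow {..<n}. ?p u v * ln (?p u v))"
    by (subst sum.cartesian_product) simp
  also have "\<dots> \<le> - (\<Sum>u\<in>Pow {..<m}. measure M (cylinder B m u) * ln (measure M (cylinder B m u)))
      - (\<Sum>v\<in>Pow {..<n}. measure M (cylinder B n v) * ln (measure M (cylinder B n v)))"
  proof (rule entropy_joint_le)
    fix u
    have "(\<Sum>v\<in>Pow {..<n}. ?p u v) = measure M (\<Union>v\<in>Pow {..<n}. cylinder B m u \<inter> ?S v)"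
      by (intro finite_measure_finite_Union[symmetric])
         (auto intro!: disjoint_family_on_bisimulation[OF disjoint_cylinder[of B n]])
    also have "(\<Union>v\<in>Pow {..<n}. cylinder B m u \<inter> ?S v) = cylinder B m u"
      using itinerary_subset[of B n] by (fastforce simp: cylinder_def action_in_space)
    finally show "(\<Sum>v\<in>Pow {..<n}. ?p u v) = measure M (cylinder B m u)" .
  next
    fix v
    show "(\<Sum>u\<in>Pow {..<m}. ?p u v) = measure M (cylinder B n v)"
      using sum_measure_Int_cylinder[of "?S v" B m]
      by (simp add: measure_action Int_commute)
  qed (simp_all add: sum_measure_cylinder)
  finally show ?thesis unfolding block_entropy_def by simp
qed

text \<open>Chebyshev's inequality for the information function \<open>- ln (measure M (cylinder B n w))\<close>.\<close>
lemma measure_small_cylinders: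
  assumes [measurable]: "B \<in> sets M" and "c > 0"
  shows "measure M {x \<in> space M. measure M (cylinder B n (itinerary B n x)) < exp (- c)}
    \<le> block_entropy B n / c"
proof -
  let ?W = "{w \<in> Pow {..<n}. measure M (cylinder B n w) < exp (- c)}"
  let ?h = "\<lambda>w. - (measure M (cylinder B n w) * ln (measure M (cylinder B n w)))"
  have h: "0 \<le> ?h w" for w
    by (intro neg_mult_ln_nonneg) auto
  have fin: "finite ?W" by (rule finite_subset[of _ "Pow {..<n}"]) auto
  have "{x \<in> space M. measure M (cylinder B n (itinerary B n x)) < exp (- c)} = (\<Union>w\<in>?W. cylinder B n w)"
    using itinerary_subset[of B n] by (auto simp: cylinder_def)
  then have "c * measure M {x \<in> space M. measure M (cylinder B n (itinerary B n x)) < exp (- c)} =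
      c * (\<Sum>w\<in>?W. measure M (cylinder B n w))"
    using fin by (simp only:) (subst finite_measure_finite_Union, auto simp: disjoint_cylinder)
  also have "\<dots> = (\<Sum>w\<in>?W. c * measure M (cylinder B n w))" by (simp add: sum_distrib_left)
  also have "\<dots> \<le> (\<Sum>w\<in>?W. ?h w)"
  proof (rule sum_mono)
    fix w assume w: "w \<in> ?W"
    \<comment> \<open>Null cylinders also lie in \<open>?W\<close>. There \<open>ln 0 = 0\<close>
      violates the bound by \<open>- c\<close>, but both sides vanish.\<close>
    show "c * measure M (cylinder B n w) \<le> ?h w"
    proof (cases "measure M (cylinder B n w) = 0")
      case False
      then have pos: "measure M (cylinder B n w) > 0" by (simp add: zero_less_measure_iff)
      then have "ln (measure M (cylinder B n w)) < - c"
        using w by (metis (mono_tags, lifting) exp_gt_zero ln_exp ln_less_cancel_iff mem_Collect_eq)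
      then show ?thesis using mult_left_mono[of c "- ln (measure M (cylinder B n w))"
        "measure M (cylinder B n w)"] by (simp add: mult.commute)
    qed simp
  qed
  also have "\<dots> \<le> (\<Sum>w\<in>Pow {..<n}. ?h w)"
    using h by (intro sum_mono2) auto
  also have "\<dots> = block_entropy B n" by (simp add: block_entropy_def sum_negf)
  finally show ?thesis using \<open>c > 0\<close> by (simp add: field_simps)
qed

text \<open>The cells of the join are the cylinders. As a set of sets the join identifies all names
  with empty cylinder, but an empty cell contributes 0 to either sum.\<close>

lemma block_entropy_eq_partition_entropy:
  assumes [measurable]: "B \<in> sets M" and U: "\<And>n. U (int n) = T ^^ n"
  shows "partition_entropy M (iterated_join M T {B, space M - B} n) = block_entropy B n"
proof -
  have "iterated_join M T {B, space M - B} n = cylinder B n ` Pow {..<n}" for n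
  proof (induction n)
    case 0
    then show ?case by (auto simp: cylinder_def itinerary_def)
  next
    case (Suc n)
    let ?S = "(T ^^ n) -` B \<inter> space M"
    let ?S' = "(T ^^ n) -` (space M - B) \<inter> space M"
    have in_S: "x \<in> ?S' \<longleftrightarrow> x \<in> space M \<and> x \<notin> ?S" for x
      using action_in_space[of x "int n"] by (auto simp: U)
    have step: "itinerary B (Suc n) x = (if x \<in> ?S then insert n (itinerary B n x) else itinerary B n x)"
      if "x \<in> space M" for x
      using that by (auto simp: itinerary_def U less_Suc_eq)
    have notin: "n \<notin> itinerary B n x" for x by (auto simp: itinerary_def)
    have ins: "cylinder B n w \<inter> ?S = cylinder B (Suc n) (insert n w)"
      and no_ins: "cylinder B n w \<inter> ?S' = cylinder B (Suc n) w" if w: "w \<in> Pow {..<n}" for w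
    proof -
      have "n \<notin> w" using w by auto
      then have "x \<in> cylinder B n w \<and> x \<in> ?S \<longleftrightarrow> x \<in> cylinder B (Suc n) (insert n w)"
        and "x \<in> cylinder B n w \<and> x \<in> ?S' \<longleftrightarrow> x \<in> cylinder B (Suc n) w" for x
        using step[of x] notin[of x] unfolding cylinder_def in_S mem_Collect_eq
        by (smt (verit) insert_ident insertI1 IntD2)+
      then show "cylinder B n w \<inter> ?S = cylinder B (Suc n) (insert n w)"
        "cylinder B n w \<inter> ?S' = cylinder B (Suc n) w" by blast+
    qed
    have "iterated_join M T {B, space M - B} (Suc n) =
        (\<lambda>w. cylinder B n w \<inter> ?S) ` Pow {..<n} \<union> (\<lambda>w. cylinder B n w \<inter> ?S') ` Pow {..<n}"
      unfolding iterated_join.simps Suc.IH partition_join_def partition_vimage_def by blast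
    also have "\<dots> = cylinder B (Suc n) ` insert n ` Pow {..<n} \<union> cylinder B (Suc n) ` Pow {..<n}"
      using ins no_ins by (simp add: image_image)
    also have "\<dots> = cylinder B (Suc n) ` Pow {..<Suc n}"
      by (simp add: lessThan_Suc Pow_insert image_Un Un_commute)
    finally show ?case .
  qed
  moreover have "(\<Sum>A\<in>cylinder B n ` Pow {..<n}. measure M A * ln (measure M A)) =
      (\<Sum>w\<in>Pow {..<n}. measure M (cylinder B n w) * ln (measure M (cylinder B n w)))"
    proof (subst sum.reindex_nontrivial)
    fix v w assume "v \<noteq> w" "cylinder B n v = cylinder B n w"
    then have "cylinder B n v = {}" by (auto simp: cylinder_def)
    then show "measure M (cylinder B n v) * ln (measure M (cylinder B n v)) = 0" by simp
  qed auto
  ultimately show ?thesis by (simp add: partition_entropy_def block_entropy_def)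
qed

text \<open>Entropy is defined with \<open>lim\<close>, which says something about the sequence only
  if it converges; subadditivity guarantees this. The partition into \<open>B\<close> and its
  complement is one of those in the supremum.\<close>

lemma eventually_block_entropy_less:
  assumes [measurable]: "B \<in> sets M" and U: "\<And>n. U (int n) = T ^^ n"
    and zero: "ks_entropy M T = 0" and e: "e > 0"
  shows "\<forall>\<^sub>F n in sequentially. block_entropy B n / real n < e"
proof -
  have "finite_partition M {B, space M - B}"
    using sets.sets_into_space[OF assms(1)] by (auto simp: finite_partition_def disjoint_def)
  then have "ereal (entropy_wrt_partition M T {B, space M - B}) \<le> 0"
    unfolding zero[symmetric] ks_entropy_def by (intro SUP_upper) auto
  then have le: "lim (\<lambda>n. block_entropy B n / real n) \<le> 0"
    using assms by (simp add: entropy_wrt_partition_def block_entropy_eq_partition_entropy)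
  have tendsto: "(\<lambda>n. block_entropy B n / real n) \<longlonglongrightarrow> lim (\<lambda>n. block_entropy B n / real n)"
    using fekete_convergent[OF block_entropy_add_le[OF assms(1)] block_entropy_nonneg]
    by (simp add: convergent_LIMSEQ_iff)
  show ?thesis by (rule order_tendstoD(2)[OF tendsto le_less_trans[OF le e]])
qed

section \<open>Rokhlin towers\<close>

text \<open>Visits in the past are what matters: the height of a point above \<open>F\<close> is
  found by descending its column.\<close>

definition recurrent_to :: "'a set \<Rightarrow> bool" where
  "recurrent_to F \<longleftrightarrow> (AE x in M. \<exists>k::nat. U (- int k) x \<in> F)"

text \<open>The set of points that visit \<open>F\<close> infinitely often in the past is strictly invariant and, as
  a decreasing limit of sets containing a translate of \<open>F\<close>, not null.\<close>
lemma ergodic_recurrent_to: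
  assumes F[measurable]: "F \<in> sets M" and pos: "measure M F > 0" and erg: "ergodic M (U 1)"
  shows "recurrent_to F"
proof -
  let ?V = "\<lambda>n. {x \<in> space M. \<exists>k::nat. n \<le> k \<and> U (- int k) x \<in> F}"
  let ?W = "\<Inter>n. ?V n"
  have V: "measure M F \<le> measure M (?V n)" for n
  proof -
    have "measure M {x \<in> space M. U (- int n) x \<in> F} \<le> measure M (?V n)"
      by (intro finite_measure_mono) auto
    then show ?thesis by (simp add: measure_action)
  qed
  have "(\<lambda>n. measure M (?V n)) \<longlonglongrightarrow> measure M ?W"
    by (intro finite_Lim_measure_decseq) (auto simp: decseq_def, meson le_trans)
  then have "measure M F \<le> measure M ?W"
    using V by (intro LIMSEQ_le_const) auto
  moreover have invariant: "U 1 -` ?W \<inter> space M = ?W"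
  proof (intro set_eqI)
    fix x
    show "x \<in> U 1 -` ?W \<inter> space M \<longleftrightarrow> x \<in> ?W"
    proof (cases "x \<in> space M")
      case x: True
      have "\<exists>k\<ge>n. U (- int k) (U 1 x) \<in> F" if "\<exists>k\<ge>n. U (- int k) x \<in> F" for n
      proof -
        from that obtain k where "k \<ge> n" "U (- int k) x \<in> F" by auto
        then show ?thesis using x by (intro exI[of _ "Suc k"]) (auto simp: action_add)
      qed
      \<comment> \<open>One step is lost in this direction, so the threshold rises to
        \<open>Suc n\<close>. The intersection over all thresholds absorbs this, and
        \<open>?W\<close> becomes strictly invariant, as \<open>ergodic\<close> requires.\<close>
      moreover have "(\<exists>k\<ge>n. U (- int k) x \<in> F)" if "(\<exists>k\<ge>Suc n. U (- int k) (U 1 x) \<in> F)" for n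
      proof -
        from that obtain k where k: "k \<ge> Suc n" "U (- int k) (U 1 x) \<in> F" by auto
        then have "U (- int (k - 1)) x \<in> F" using x by (simp add: action_add of_nat_diff)
        then show ?thesis using k by (intro exI[of _ "k - 1"]) auto
      qed
      ultimately show ?thesis using x action_in_space[OF x, of 1] by auto
    qed auto
  qed
  moreover have "?W \<in> sets M" by measurable
  then have "measure M ?W = 0 \<or> measure M ?W = 1"
    using erg invariant unfolding ergodic_def by blast
  ultimately have "measure M ?W = 1" using pos by linarith
  then have "AE x in M. x \<in> ?W" using \<open>?W \<in> sets M\<close> by (simp add: prob_eq_1)
  then show ?thesis unfolding recurrent_to_def by (rule AE_mp) (intro AE_I2, blast)
qed

text \<open>Pairwise disjointness of the levels over \<open>E\<close> is put pointwise, and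
  \<open>tower\<close> uses preimages, so that no image of a set has to be shown measurable.\<close>

definition tower_base :: "nat \<Rightarrow> 'a set \<Rightarrow> bool" where
  "tower_base n E \<longleftrightarrow> E \<in> sets M \<and>
     (\<forall>x\<in>E. \<forall>y\<in>E. \<forall>a<n. \<forall>b<n. U (int a) x = U (int b) y \<longrightarrow> a = b)"

definition tower :: "nat \<Rightarrow> 'a set \<Rightarrow> 'a set" where
  "tower n E = {x \<in> space M. \<exists>j<n. U (- int j) x \<in> E}"

lemma sets_tower [measurable]:
  assumes [measurable]: "E \<in> sets M"
  shows "tower n E \<in> sets M"
  unfolding tower_def by measurable

lemma measure_Union_action_le:
  assumes [measurable]: "F \<in> sets M" and J: "finite J"
  shows "measure M {x \<in> space M. \<exists>j\<in>J. U (g j) x \<in> F} \<le> real (card J) * measure M F"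
proof -
  have "{x \<in> space M. \<exists>j\<in>J. U (g j) x \<in> F} = (\<Union>j\<in>J. {x \<in> space M. U (g j) x \<in> F})" by auto
  then have "measure M {x \<in> space M. \<exists>j\<in>J. U (g j) x \<in> F} \<le>
      (\<Sum>j\<in>J. measure M {x \<in> space M. U (g j) x \<in> F})"
    using J by (simp only:) (intro finite_measure_subadditive_finite, auto)
  then show ?thesis by (simp add: measure_action)
qed

text \<open>The \<open>n\<close> levels are disjoint and of equal measure. The bound prices each
  level changed by the coding at \<open>1 / n\<close>, and it also excludes atoms at points that are
  not periodic.\<close>

lemma measure_tower_base:
  assumes "tower_base n E"
  shows "real n * measure M E \<le> 1"
proof -
  have [measurable]: "E \<in> sets M" using assms by (simp add: tower_base_def)
  have "real n * measure M E = (\<Sum>j<n. measure M {x \<in> space M. U (- int j) x \<in> E})"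
    by (simp add: measure_action)
  also have "\<dots> = measure M (\<Union>j<n. {x \<in> space M. U (- int j) x \<in> E})"
  proof (intro finite_measure_finite_Union[symmetric])
    show "disjoint_family_on (\<lambda>j. {x \<in> space M. U (- int j) x \<in> E}) {..<n}"
    proof (clarsimp simp: disjoint_family_on_def, intro equals0I, clarsimp)
      fix a b x assume *: "a < n" "b < n" "a \<noteq> b" "x \<in> space M" "U (- int a) x \<in> E" "U (- int b) x \<in> E"
      moreover have "U (int a) (U (- int a) x) = U (int b) (U (- int b) x)"
        using * by (simp add: action_add action_zero)
      ultimately show False using assms unfolding tower_base_def by blast
    qed
  qed auto
  finally show ?thesis by simp
qed

text \<open>Kakutani's skyscraper over \<open>F\<close> is cut into blocks of height \<open>n\<close>. The \<open>n\<close> possible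
  offsets of the cuts give disjoint bases, so one of them lies mostly in \<open>G\<close>.\<close>
lemma tower_base_subset_exists:
  assumes F[measurable]: "F \<in> sets M" and rec: "recurrent_to F"
    and G[measurable]: "G \<in> sets M" and n: "n > 0"
  obtains E where "tower_base n E" "E \<subseteq> G"
    "measure M (space M - tower n E) \<le> 2 * real n * measure M F + measure M (space M - G)"
proof -
  \<comment> \<open>Level \<open>k\<close> of the skyscraper: the last visit to \<open>F\<close> was
    exactly \<open>k\<close> steps ago.\<close>
  define R where "R k = {x \<in> space M. U (- int k) x \<in> F \<and> (\<forall>l<k. U (- int l) x \<notin> F)}" for k
  have [measurable]: "R k \<in> sets M" for k unfolding R_def by measurable
  have R_unique: "k = l" if "x \<in> R k" "x \<in> R l" for x k l
    using that by (auto simp: R_def) (meson linorder_neqE_nat)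
  have R_shift: "U (int d) x \<in> R (k + d)"
    if x: "x \<in> R k" and no: "\<And>j. 0 < j \<Longrightarrow> j \<le> d \<Longrightarrow> U (int j) x \<notin> F" for x k d
  proof -
    have xs: "x \<in> space M" using x by (simp add: R_def)
    have "U (- int l) (U (int d) x) \<notin> F" if "l < k + d" for l
    proof (cases "l < d")
      case True
      then show ?thesis using no[of "d - l"] xs by (simp add: action_add of_nat_diff)
    next
      case False
      then have "l - d < k" using that by linarith
      then have "U (- int (l - d)) x \<notin> F" using x unfolding R_def by blast
      moreover have "- int l + int d = - int (l - d)" using False by simp
      ultimately show ?thesis using xs by (simp only: action_add not_False_eq_True)
    qed
    then show ?thesis using x by (auto simp: R_def action_add action_in_space)
  qed
  \<comment> \<open>Cuts are made at the heights congruent to \<open>i\<close> modulo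
    \<open>n\<close>; only full blocks are kept, where the next \<open>n - 1\<close> steps avoid
    \<open>F\<close>.\<close>
  define E where "E i = {x \<in> space M. (\<exists>k. k mod n = i \<and> x \<in> R k) \<and> (\<forall>j\<in>{1..<n}. U (int j) x \<notin> F)}" for i
  have [measurable]: "E i \<in> sets M" for i unfolding E_def by measurable
  \<comment> \<open>If the levels \<open>a\<close> and \<open>b\<close> meet, \<open>x\<close> lies
    \<open>b - a\<close> steps above \<open>y\<close> in one column. Both heights are congruent to
    \<open>i\<close>, so \<open>n\<close> divides \<open>b - a\<close>, which is less than
    \<open>n\<close>.\<close>
  have *: "a = b" if "x \<in> E i" "y \<in> E i" "a \<le> b" "b < n" "U (int a) x = U (int b) y" for i x y a b
  proof -
    have xy: "x \<in> space M" "y \<in> space M" using that by (auto simp: E_def)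
    have "x = U (- int a) (U (int a) x)" using xy by (simp add: action_add action_zero)
    also have "\<dots> = U (int (b - a)) y"
      using xy that by (simp add: action_add of_nat_diff)
    finally have x: "x = U (int (b - a)) y" .
    have in_E: "x \<in> E i" "y \<in> E i" by fact+
    then obtain k l where kl: "x \<in> R k" "y \<in> R l" "k mod n = i" "l mod n = i"
      unfolding E_def by blast
    have "x \<in> R (l + (b - a))"
      unfolding x using that by (intro R_shift kl) (auto simp: E_def)
    with kl R_unique have "(l + (b - a)) mod n = l mod n" by force
    then have "n dvd b - a" by (simp add: mod_eq_dvd_iff_nat)
    then show ?thesis using that by (auto dest: dvd_imp_le)
  qed
  have base: "tower_base n (E i)" for i
    unfolding tower_base_def using *[of _ i] by (auto, metis nat_le_linear)
  have disj: "disjoint_family_on (\<lambda>i. E i - G) {..<n}"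
  proof -
    have "i = j" if "x \<in> E i" "x \<in> E j" for x i j
      using that R_unique unfolding E_def by blast
    then show ?thesis unfolding disjoint_family_on_def by blast
  qed
  \<comment> \<open>The height determines the offset, so the sets \<open>E i - G\<close> are
    disjoint inside the complement of \<open>G\<close>, and one of them has at most the average
    measure. The \<open>n\<close> levels over it then weigh at most as much as that
    complement.\<close>
  have "\<exists>i<n. real n * measure M (E i - G) \<le> measure M (space M - G)"
  proof (rule ccontr)
    assume "\<not> ?thesis"
    then have "(\<Sum>i<n. measure M (space M - G)) < (\<Sum>i<n. real n * measure M (E i - G))"
      using n by (intro sum_strict_mono) (auto simp: not_le)
    also have "\<dots> = real n * measure M (\<Union>i<n. E i - G)"
      by (subst finite_measure_finite_Union) (auto simp: disj sum_distrib_left)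
    also have "\<dots> \<le> real n * measure M (space M - G)"
      by (intro mult_left_mono finite_measure_mono) (auto simp: E_def)
    finally show False by simp
  qed
  then obtain i where i: "i < n" "real n * measure M (E i - G) \<le> measure M (space M - G)" by auto
  \<comment> \<open>Four reasons for a point not to be covered: no past visit to \<open>F\<close> at
    all, a recent visit, an imminent visit, or a column whose base point lies outside
    \<open>G\<close>.\<close>
  let ?N = "{x \<in> space M. \<forall>k::nat. U (- int k) x \<notin> F}"
  let ?P = "{x \<in> space M. \<exists>j\<in>{..<n}. U (- int j) x \<in> F}"
  let ?Q = "{x \<in> space M. \<exists>j\<in>{..<n}. U (int j) x \<in> F}"
  let ?X = "{x \<in> space M. \<exists>j\<in>{..<n}. U (- int j) x \<in> E i - G}"
  have "space M - tower n (E i \<inter> G) \<subseteq> ?N \<union> (?P \<union> ?Q \<union> ?X)"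
  proof (intro subsetI, rule ccontr)
    fix z assume z: "z \<in> space M - tower n (E i \<inter> G)" "z \<notin> ?N \<union> (?P \<union> ?Q \<union> ?X)"
    then have zs: "z \<in> space M" by simp
    have "\<exists>k. U (- int k) z \<in> F" using z by auto
    then obtain k where k: "z \<in> R k"
      unfolding R_def using zs exists_least_iff[of "\<lambda>k. U (- int k) z \<in> F"] by auto
    have kn: "k \<ge> n" using k z by (auto simp: R_def not_le)
    \<comment> \<open>The way down from height \<open>k\<close> to the nearest cut; since
      \<open>k \<ge> n > i\<close>, the subtraction is not truncated.\<close>
    define a where "a = (k - i) mod n"
    have an: "a < n" "a \<le> k" using n kn by (auto simp: a_def intro: order.trans[OF mod_le_divisor])
    have x: "U (- int a) z \<in> space M" using zs by (rule action_in_space)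
    have "U (- int l) (U (- int a) z) = U (- int (l + a)) z" for l
      using zs by (simp add: action_add)
    moreover have "U (- int (l + a)) z \<notin> F" if "l < k - a" for l
      using k that unfolding R_def by (metis (mono_tags, lifting) less_diff_conv mem_Collect_eq)
    moreover have "U (- int (k - a + a)) z \<in> F" using k an by (simp add: R_def)
    ultimately have "U (- int a) z \<in> R (k - a)"
      unfolding R_def using x by simp
    moreover have "(k - a) mod n = i"
    proof -
      have "k - i = (k - i) div n * n + a" by (simp add: a_def)
      then have "k - a = i + (k - i) div n * n" using kn i(1) by linarith
      then show ?thesis using i(1) by simp
    qed
    \<comment> \<open>Up to \<open>z\<close> the points of the block lie fewer than \<open>k\<close>
      steps below \<open>z\<close>, because \<open>j \<ge> 1\<close>; beyond \<open>z\<close> the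
      set \<open>?Q\<close> has been excluded. The bottom point, \<open>j = 0\<close>, may belong to
      \<open>F\<close>.\<close>
    moreover have "U (int j) (U (- int a) z) \<notin> F" if "j \<in> {1..<n}" for j
    proof (cases "j \<le> a")
      case True
      then have "a - j < k" using that an by auto
      then have "U (- int (a - j)) z \<notin> F" using k unfolding R_def by blast
      then show ?thesis using True zs by (simp add: action_add of_nat_diff)
    next
      case False
      have "j - a < n" using that by auto
      then have "U (int (j - a)) z \<notin> F" using z zs by blast
      then show ?thesis using False zs by (simp add: action_add of_nat_diff)
    qed
    ultimately have "U (- int a) z \<in> E i" using x by (auto simp: E_def)
    then show False using z an by (auto simp: tower_def)
  qed
  then have "measure M (space M - tower n (E i \<inter> G)) \<le> measure M (?N \<union> (?P \<union> ?Q \<union> ?X))"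
    by (intro finite_measure_mono) auto
  also have "\<dots> \<le> measure M ?N + (measure M ?P + measure M ?Q + measure M ?X)"
    by (intro order.trans[OF measure_Un_le] add_mono order.refl) auto
  also have "measure M ?N = 0"
  proof -
    have "AE x in M. x \<notin> ?N" using rec unfolding recurrent_to_def by (rule AE_mp) auto
    then show ?thesis by (subst prob_eq_0) auto
  qed
  also have "measure M ?P + measure M ?Q + measure M ?X \<le>
      real n * measure M F + real n * measure M F + real n * measure M (E i - G)"
    using measure_Union_action_le[of F "{..<n}" "\<lambda>j. - int j"]
      measure_Union_action_le[of F "{..<n}" "\<lambda>j. int j"]
      measure_Union_action_le[of "E i - G" "{..<n}" "\<lambda>j. - int j"]
    by (intro add_mono) auto
  finally have "measure M (space M - tower n (E i \<inter> G)) \<le>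
      2 * real n * measure M F + measure M (space M - G)" using i(2) by linarith
  moreover have "tower_base n (E i \<inter> G)" using base[of i] by (auto simp: tower_base_def)
  ultimately show ?thesis by (intro that) auto
qed

section \<open>Coding names into a set\<close>

text \<open>A sliding block code with window \<open>I\<close> and accepted patterns
  \<open>F\<close>. For finite \<open>I\<close> these are the finite Boolean combinations of the
  translates of \<open>A\<close>.\<close>

definition window_code :: "'a set \<Rightarrow> int set \<Rightarrow> int set set \<Rightarrow> 'a set" where
  "window_code A I F = {x \<in> space M. {k \<in> I. U k x \<in> A} \<in> F}"

lemma tower_level_unique:
  assumes "tower_base n E" "x \<in> space M" "a < n" "b < n" "U (- int a) x \<in> E" "U (- int b) x \<in> E"
  shows "a = b"
proof -
  have "U (int a) (U (- int a) x) = U (int b) (U (- int b) x)"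
    using assms by (simp add: action_add action_zero)
  then show ?thesis using assms unfolding tower_base_def by blast
qed

text \<open>Disjoint sets of measure at least \<open>(1/2) ^ c\<close> number at most
  \<open>2 ^ c\<close>, so words of \<open>c\<close> bits can name them.\<close>

lemma inj_on_likely_cylinders:
  assumes B: "B \<in> sets M"
  obtains \<phi> where "inj_on \<phi> {w \<in> Pow {..<n}. (1/2) ^ c \<le> measure M (cylinder B n w)}"
    "\<And>w. w \<in> Pow {..<n} \<Longrightarrow> (1/2) ^ c \<le> measure M (cylinder B n w) \<Longrightarrow> \<phi> w \<subseteq> {..<c :: nat}"
proof -
  let ?W = "{w \<in> Pow {..<n}. (1/2) ^ c \<le> measure M (cylinder B n w)}"
  have fin: "finite ?W" by (rule finite_subset[of _ "Pow {..<n}"]) auto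
  have "real (card ?W) * (1/2) ^ c \<le> (\<Sum>w\<in>?W. measure M (cylinder B n w))"
    using sum_bounded_below[of ?W "(1/2) ^ c" "\<lambda>w. measure M (cylinder B n w)"] by simp
  also have "\<dots> \<le> (\<Sum>w\<in>Pow {..<n}. measure M (cylinder B n w))"
    by (intro sum_mono2) auto
  also have "\<dots> = 1" using B by (rule sum_measure_cylinder)
  finally have "real (card ?W) \<le> real (card (Pow {..<c}))"
    by (simp add: card_Pow field_simps power_one_over)
  then have "card ?W \<le> card (Pow {..<c})" by linarith
  then obtain \<phi> where "\<phi> ` ?W \<subseteq> Pow {..<c}" "inj_on \<phi> ?W"
    using card_le_inj[OF fin, of "Pow {..<c}"] by auto
  then show ?thesis by (intro that[of \<phi>]) auto
qed

text \<open>The itinerary of \<open>B\<close> along each column of the tower is written into \<open>A\<close>. The levels below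
  \<open>m\<close> form a marker that occurs nowhere else, because from level \<open>m\<close> on every multiple of \<open>m\<close> and the
  top level are left out of \<open>A\<close>. Bit \<open>i\<close> of the code word sits at level \<open>m + 2 * i + 1\<close>, which is
  not a multiple of \<open>m\<close> since \<open>m\<close> is even.\<close>
lemma tower_coding:
  assumes A0[measurable]: "A0 \<in> sets M" and B[measurable]: "B \<in> sets M"
    and base: "tower_base n E"
    and likely: "\<And>x. x \<in> E \<Longrightarrow> (1/2) ^ c \<le> measure M (cylinder B n (itinerary B n x))"
    and m: "even m" "m > 0" and n: "m + 2 * c + 1 < n"
  obtains A I F where "A \<in> sets M" "finite I"
    "measure M (sym_diff A A0) \<le>
      measure M (space M - tower n E) + (real m + real n / real m + 2 + real c) / real n"
    "measure M (sym_diff B (window_code A I F)) \<le> measure M (space M - tower n E)"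
proof -
  let ?W = "{w \<in> Pow {..<n}. (1/2) ^ c \<le> measure M (cylinder B n w)}"
  have E[measurable]: "E \<in> sets M" using base by (simp add: tower_base_def)
  have E_space: "x \<in> space M" if "x \<in> E" for x using that sets.sets_into_space[OF E] by auto
  obtain \<phi> where inj: "inj_on \<phi> ?W"
    and \<phi>: "\<And>w. w \<in> Pow {..<n} \<Longrightarrow> (1/2) ^ c \<le> measure M (cylinder B n w) \<Longrightarrow> \<phi> w \<subseteq> {..<c}"
    using inj_on_likely_cylinders[OF B, of n c] by blast
  have E_W: "itinerary B n x \<in> ?W" if "x \<in> E" for x
    using likely[OF that] itinerary_subset[of B n x] by auto
  \<comment> \<open>The base points whose code word has bit \<open>i\<close> set. Naming them as
    finite unions of cylinders makes the measurability of \<open>A\<close> automatic.\<close>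
  define K where "K i = (\<Union>w\<in>{w \<in> Pow {..<n}. i \<in> \<phi> w}. cylinder B n w)" for i
  have [measurable]: "K i \<in> sets M" for i
    unfolding K_def by (intro sets.finite_UN) (auto intro: finite_subset[of _ "Pow {..<n}"])
  have K: "x \<in> K i \<longleftrightarrow> i \<in> \<phi> (itinerary B n x)" if "x \<in> space M" for x i
    using that itinerary_subset[of B n x] by (auto simp: K_def cylinder_def)
  define P where "P j y \<longleftrightarrow> j < m \<or> \<not> m dvd j \<and> j \<noteq> n - 1 \<and>
    ((\<exists>i<c. j = m + 2 * i + 1 \<and> y \<in> K i) \<or> (\<forall>i<c. j \<noteq> m + 2 * i + 1) \<and> U (int j) y \<in> A0)" for j y
  \<comment> \<open>Points outside the tower are dropped from \<open>A\<close>. No marker can then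
    begin there, and the cost is only the measure of the complement of the tower.\<close>
  define A where "A = {x \<in> space M. \<exists>j<n. U (- int j) x \<in> E \<and> P j (U (- int j) x)}"
  have A[measurable]: "A \<in> sets M" unfolding A_def P_def by measurable
  have level: "U (int j) y \<in> A \<longleftrightarrow> P j y" if "y \<in> E" "j < n" for j y
  proof -
    have y: "y \<in> space M" using that E_space by blast
    have return: "U (- int j) (U (int j) y) = y" using y by (simp add: action_add action_zero)
    have "j' = j" if "j' < n" "U (- int j') (U (int j) y) \<in> E" for j'
      using tower_level_unique[OF base action_in_space[OF y] that(1) \<open>j < n\<close> that(2)] \<open>y \<in> E\<close> return
      by simp
    then have "U (int j) y \<in> A \<longleftrightarrow> U (- int j) (U (int j) y) \<in> E \<and> P j (U (- int j) (U (int j) y))"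
      using that action_in_space[OF y] unfolding A_def by blast
    then show ?thesis using that return by simp
  qed
  have bit: "U (int (m + 2 * i + 1)) y \<in> A \<longleftrightarrow> i \<in> \<phi> (itinerary B n y)" if "y \<in> E" "i < c" for i y
  proof -
    have "\<not> m dvd m + 2 * i + 1" using m(1) by (meson dvd_trans even_add even_plus_one_iff dvd_triv_left)
    then show ?thesis
      using that n K[OF E_space[OF that(1)]] by (subst level) (auto simp: P_def)
  qed
  have marker: "(\<forall>i<m. U (int i) y \<in> A) \<longleftrightarrow> y \<in> E" if y: "y \<in> space M" for y
  proof
    assume all: "\<forall>i<m. U (int i) y \<in> A"
    then have "U (int 0) y \<in> A" using m by blast
    then have "y \<in> A" using y by (simp add: action_zero)
    then obtain j where j: "j < n" "U (- int j) y \<in> E" by (auto simp: A_def)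
    have no: False if "i < m" "j + i < n" "\<not> P (j + i) (U (- int j) y)" for i
    proof -
      have "U (int (j + i)) (U (- int j) y) \<notin> A" using level that j by blast
      moreover have "U (int (j + i)) (U (- int j) y) = U (int i) y" using y by (simp add: action_add)
      ultimately show False using all that by auto
    qed
    have "j = 0"
    proof (rule ccontr)
      assume "j \<noteq> 0"
      \<comment> \<open>Climbing from a level \<open>j > 0\<close>, a run of \<open>m\<close> points
        of \<open>A\<close> would have to pass a forbidden level: level \<open>m\<close>, or the top
        level if it is within reach, or else the next multiple of \<open>m\<close>.\<close>
      consider "j < m" | "j \<ge> m" "n - 1 - j < m" | "j \<ge> m" "n - 1 - j \<ge> m" by linarith
      then show False
      proof cases
        case 1
        then show False using no[of "m - j"] n \<open>j \<noteq> 0\<close> by (auto simp: P_def)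
      next
        case 2
        moreover have "\<not> n - 1 < m" "j + (n - 1 - j) = n - 1" using n j by linarith+
        ultimately show False using no[of "n - 1 - j"] j n by (simp add: P_def)
      next
        case 3
        \<comment> \<open>The distance to the next multiple of \<open>m\<close>; the outer
          \<open>mod\<close> gives 0 when \<open>j\<close> is already one.\<close>
        define i where "i = (m - j mod m) mod m"
        have "i < m" using m by (simp add: i_def)
        then have "j + i < n" "j + i \<ge> m" using 3 by linarith+
        moreover have "m dvd j + i"
        proof -
          have "(j + i) mod m = (j mod m + (m - j mod m)) mod m" by (simp add: i_def mod_simps)
          also have "\<dots> = 0" using m by simp
          finally show ?thesis by (simp add: dvd_eq_mod_eq_0)
        qed
        ultimately show False using no[of i] \<open>i < m\<close> by (auto simp: P_def)
      qed
    qed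
    then show "y \<in> E" using j y by (simp add: action_zero)
  next
    assume "y \<in> E"
    then show "\<forall>i<m. U (int i) y \<in> A" using n by (auto simp: level P_def)
  qed
  \<comment> \<open>The decoder looks for a marker \<open>j\<close> steps below the current point,
    reads the code word above the marker, and accepts if the name so coded contains position
    \<open>j\<close>.\<close>
  define F where "F = {s. \<exists>j<n. \<exists>w\<in>?W. j \<in> w \<and> (\<forall>i<m. int i - int j \<in> s) \<and>
    (\<forall>i<c. int (m + 2 * i + 1) - int j \<in> s \<longleftrightarrow> i \<in> \<phi> w)}"
  \<comment> \<open>Both the marker and the code word lie in the column of the current point, hence
    less than \<open>n\<close> steps away.\<close>
  let ?I = "{- int n..int n}"
  let ?C = "window_code A ?I F"
  have code: "x \<in> ?C \<longleftrightarrow> (\<exists>j<n. \<exists>w\<in>?W. j \<in> w \<and> U (- int j) x \<in> E \<and> \<phi> (itinerary B n (U (- int j) x)) = \<phi> w)"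
    if x: "x \<in> space M" for x
  proof -
    have inner: "(\<forall>i<m. int i - int j \<in> {k \<in> ?I. U k x \<in> A}) \<and>
        (\<forall>i<c. int (m + 2 * i + 1) - int j \<in> {k \<in> ?I. U k x \<in> A} \<longleftrightarrow> i \<in> \<phi> w) \<longleftrightarrow>
        U (- int j) x \<in> E \<and> \<phi> (itinerary B n (U (- int j) x)) = \<phi> w" if "j < n" "w \<in> ?W" for j w
    proof -
      let ?y = "U (- int j) x"
      have U: "U (int k - int j) x = U (int k) ?y" for k using x by (simp add: action_add)
      have "(\<forall>i<m. int i - int j \<in> {k \<in> ?I. U k x \<in> A}) \<longleftrightarrow> ?y \<in> E"
        unfolding marker[OF action_in_space[OF x], symmetric] using n that by (auto simp: U)
      moreover have "(\<forall>i<c. int (m + 2 * i + 1) - int j \<in> {k \<in> ?I. U k x \<in> A} \<longleftrightarrow> i \<in> \<phi> w) \<longleftrightarrow>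
          \<phi> (itinerary B n ?y) = \<phi> w" if "?y \<in> E"
      proof -
        have "int (m + 2 * i + 1) - int j \<in> {k \<in> ?I. U k x \<in> A} \<longleftrightarrow> i \<in> \<phi> (itinerary B n ?y)" if "i < c" for i
          unfolding bit[OF \<open>?y \<in> E\<close> that, symmetric] U[symmetric] using n that \<open>j < n\<close> by auto
        moreover have "\<phi> (itinerary B n ?y) \<subseteq> {..<c}" "\<phi> w \<subseteq> {..<c}"
          using E_W[OF \<open>?y \<in> E\<close>] \<open>w \<in> ?W\<close> \<phi> by auto
        ultimately show ?thesis by blast
      qed
      ultimately show ?thesis by blast
    qed
    have "x \<in> ?C \<longleftrightarrow> {k \<in> ?I. U k x \<in> A} \<in> F" using x by (simp add: window_code_def)
    also have "\<dots> \<longleftrightarrow> (\<exists>j<n. \<exists>w\<in>?W. j \<in> w \<and> (\<forall>i<m. int i - int j \<in> {k \<in> ?I. U k x \<in> A}) \<and>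
        (\<forall>i<c. int (m + 2 * i + 1) - int j \<in> {k \<in> ?I. U k x \<in> A} \<longleftrightarrow> i \<in> \<phi> w))"
      unfolding F_def by (rule mem_Collect_eq)
    finally show ?thesis by (simp only: inner cong: conj_cong bex_cong)
  qed
  \<comment> \<open>On the tower the decoder is exact: disjoint levels leave only one possible
    \<open>j\<close>, and injectivity of \<phi> on the likely names leaves only one name.\<close>
  have C_B: "x \<in> ?C \<longleftrightarrow> x \<in> B" if x: "x \<in> tower n E" for x
  proof -
    from x obtain j where j: "j < n" "U (- int j) x \<in> E" and xs: "x \<in> space M" by (auto simp: tower_def)
    let ?w = "itinerary B n (U (- int j) x)"
    have "x \<in> B \<longleftrightarrow> j \<in> ?w" using j xs by (auto simp: itinerary_def action_add action_zero)
    moreover have "x \<in> ?C \<longleftrightarrow> j \<in> ?w"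
    proof
      assume "x \<in> ?C"
      then obtain j' w where j': "j' < n" "w \<in> ?W" "j' \<in> w" "U (- int j') x \<in> E"
        "\<phi> (itinerary B n (U (- int j') x)) = \<phi> w"
        using code[OF xs] by blast
      have "j' = j" using tower_level_unique[OF base xs j'(1) j(1) j'(4) j(2)] .
      then have "?w = w" using inj_onD[OF inj j'(5) E_W[OF j'(4)] j'(2)] by simp
      then show "j \<in> ?w" using \<open>j' = j\<close> j'(3) by simp
    next
      assume "j \<in> ?w"
      then show "x \<in> ?C" using code[OF xs] j E_W by blast
    qed
    ultimately show ?thesis by simp
  qed
  have B_C: "measure M (sym_diff B ?C) \<le> measure M (space M - tower n E)"
    using C_B sets.sets_into_space[OF B]
    by (intro finite_measure_mono) (auto simp: window_code_def)
  \<comment> \<open>The levels where \<open>A\<close> may disagree with \<open>A0\<close>: marker,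
    multiples of \<open>m\<close>, top, code word. The multiples include 0, whence the summand
    \<open>n div m + 1\<close> in the count.\<close>
  let ?J = "{..<m} \<union> {j. j < n \<and> m dvd j} \<union> {n - 1} \<union> (\<lambda>i. m + 2 * i + 1) ` {..<c}"
  have cardJ: "card ?J \<le> m + (n div m + 1) + 1 + c"
  proof -
    have "{j. j < n \<and> m dvd j} \<subseteq> (\<lambda>q. m * q) ` {..n div m}"
    proof
      fix j assume "j \<in> {j. j < n \<and> m dvd j}"
      then obtain q where "j = m * q" "j < n" by auto
      then show "j \<in> (\<lambda>q. m * q) ` {..n div m}" using m
        by (auto simp: less_eq_div_iff_mult_less_eq mult.commute)
    qed
    then have "card {j. j < n \<and> m dvd j} \<le> n div m + 1"
      using surj_card_le[of "{..n div m}"] by fastforce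
    moreover have "card ((\<lambda>i. m + 2 * i + 1) ` {..<c}) \<le> c"
      using card_image_le[of "{..<c}" "\<lambda>i. m + 2 * i + 1"] by simp
    moreover have "card ?J \<le> card {..<m} + card {j. j < n \<and> m dvd j} + card {n - 1} +
        card ((\<lambda>i. m + 2 * i + 1) ` {..<c})"
      by (intro order.trans[OF card_Un_le] add_mono order.refl)
    ultimately show ?thesis by simp
  qed
  have "sym_diff A A0 \<subseteq> (space M - tower n E) \<union> {x \<in> space M. \<exists>j\<in>?J. U (- int j) x \<in> E}"
  proof
    fix x assume x: "x \<in> sym_diff A A0"
    then have xs: "x \<in> space M" using sets.sets_into_space[OF A0] by (auto simp: A_def)
    show "x \<in> (space M - tower n E) \<union> {x \<in> space M. \<exists>j\<in>?J. U (- int j) x \<in> E}"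
    proof (rule ccontr)
      assume no: "\<not> ?thesis"
      then obtain j where j: "j < n" "U (- int j) x \<in> E" using xs by (auto simp: tower_def)
      then have "j \<notin> ?J" using no xs by blast
      then have "P j (U (- int j) x) \<longleftrightarrow> U (int j) (U (- int j) x) \<in> A0"
        using j by (auto simp: P_def)
      then show False using x level[OF j(2,1)] xs by (auto simp: action_add action_zero)
    qed
  qed
  then have "measure M (sym_diff A A0) \<le>
      measure M ((space M - tower n E) \<union> {x \<in> space M. \<exists>j\<in>?J. U (- int j) x \<in> E})"
    by (intro finite_measure_mono) auto
  also have "\<dots> \<le> measure M (space M - tower n E) + real (card ?J) * measure M E"
    using measure_Union_action_le[OF E, of ?J "\<lambda>j. - int j"]
    by (intro order.trans[OF measure_Un_le] add_mono order.refl) auto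
  also have "\<dots> \<le> measure M (space M - tower n E) + (real m + real n / real m + 2 + real c) * (1 / real n)"
  proof (intro add_mono mult_mono order.refl)
    have "real (card ?J) \<le> real (m + (n div m + 1) + 1 + c)" using cardJ by (rule of_nat_mono)
    then show "real (card ?J) \<le> real m + real n / real m + 2 + real c"
      using of_nat_div_le_of_nat[where 'a = real, of n m] by simp
    show "measure M E \<le> 1 / real n" using measure_tower_base[OF base] n by (simp add: field_simps)
  qed auto
  finally show ?thesis using that[of A ?I F] A B_C by simp
qed

text \<open>Here the parameters are chosen: \<delta> first, then \<open>m\<close> from \<delta>,
  then a large \<open>n\<close>, then \<open>c\<close>. The tower misses at most
  \<open>2 * \<delta>\<close>, half of it from \<open>F\<close> and half from unlikely names, and
  the changed levels make up at most \<open>3 * \<delta>\<close>.\<close>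

lemma window_code_dense:
  assumes A0: "A0 \<in> sets M" and B: "B \<in> sets M" and erg: "ergodic M (U 1)"
    and small: "\<And>e. e > 0 \<Longrightarrow> \<exists>F\<in>sets M. 0 < measure M F \<and> measure M F < e"
    and entropy: "\<And>e. e > 0 \<Longrightarrow> \<forall>\<^sub>F n in sequentially. block_entropy B n / real n < e"
    and \<epsilon>: "\<epsilon> > 0"
  obtains A I F where "A \<in> sets M" "finite I" "measure M (sym_diff A A0) < \<epsilon>"
    "measure M (sym_diff B (window_code A I F)) < \<epsilon>"
proof -
  \<comment> \<open>The errors are at most \<open>5 * \<delta>\<close> for \<open>A0\<close> and
    \<open>2 * \<delta>\<close> for \<open>B\<close>; the factor 7 leaves room for strictness. The
    bound \<open>1 / 4\<close> lets marker and code word fit below the top of a column.\<close>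
  define \<delta> where "\<delta> = min (\<epsilon> / 7) (1 / 4)"
  have \<delta>: "\<delta> > 0" "7 * \<delta> \<le> \<epsilon>" "\<delta> \<le> 1 / 4" using \<epsilon> by (auto simp: \<delta>_def)
  \<comment> \<open>With \<open>m \<ge> 1 / \<delta>\<close>, the multiples of \<open>m\<close>
    occupy a proportion of about \<delta> of the levels; the factor 2 makes \<open>m\<close>
    even.\<close>
  define m where "m = 2 * nat \<lceil>1 / \<delta>\<rceil>"
  have "1 / \<delta> \<le> real (nat \<lceil>1 / \<delta>\<rceil>)" by (rule real_nat_ceiling_ge)
  then have m: "even m" "1 / \<delta> \<le> real m" by (auto simp: m_def)
  have m0: "m > 0" using m(2) \<delta> by (metis divide_pos_pos gr0I less_numeral_extra(1) linorder_not_less of_nat_0)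
  \<comment> \<open>Chebyshev's inequality will divide the block entropy by
    \<open>real c * ln 2\<close>, at least \<open>\<delta> * n * ln 2\<close>, so the bound
    \<open>\<delta>\<^sup>2 * ln 2\<close> leaves \<delta>. The second condition makes the marker
    cheap; its 5 absorbs the roundings.\<close>
  have "\<forall>\<^sub>F n in sequentially. block_entropy B n / real n < \<delta>\<^sup>2 * ln 2 \<and> (real m + 5) / \<delta> \<le> real n"
    using \<delta> filterlim_real_sequentially
    by (intro eventually_conj entropy) (auto simp: filterlim_at_top)
  then obtain n where n: "block_entropy B n / real n < \<delta>\<^sup>2 * ln 2" "(real m + 5) / \<delta> \<le> real n"
    by (auto simp: eventually_sequentially)
  have n': "real m + 5 \<le> \<delta> * real n" using n(2) \<delta> by (simp add: field_simps)
  then have n0: "n > 0" using \<delta> by (cases n) auto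
  define c where "c = nat \<lceil>\<delta> * real n\<rceil>"
  have "real c = of_int \<lceil>\<delta> * real n\<rceil>" using \<delta> by (simp add: c_def)
  then have c: "\<delta> * real n \<le> real c" "real c \<le> \<delta> * real n + 1" by linarith+
  have \<delta>n: "\<delta> * real n \<le> real n / 4" using \<delta>(3) mult_right_mono[of \<delta> "1/4" "real n"] by simp
  have "real (m + 2 * c + 1) < real n" using c n' \<delta>n by simp
  then have mcn: "m + 2 * c + 1 < n" by linarith
  have c0: "c > 0" using c(1) n' by (cases c) auto
  have exp_c: "exp (- (real c * ln 2)) = (1/2) ^ c"
    by (simp add: exp_minus exp_of_nat_mult power_one_over inverse_eq_divide)
  define G where "G = {x \<in> space M. (1/2) ^ c \<le> measure M (cylinder B n (itinerary B n x))}"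
  have G_compl: "space M - G = {x \<in> space M. measure M (cylinder B n (itinerary B n x)) < (1/2) ^ c}"
    by (auto simp: G_def)
  have "space M - G = (\<Union>w\<in>{w\<in>Pow {..<n}. measure M (cylinder B n w) < (1/2) ^ c}. cylinder B n w)"
    unfolding G_compl using itinerary_subset[of B n] by (auto simp: cylinder_def)
  also have "\<dots> \<in> sets M"
    using B by (intro sets.finite_UN) (auto intro: finite_subset[of _ "Pow {..<n}"])
  finally have "space M - (space M - G) \<in> sets M" by blast
  moreover have "space M - (space M - G) = G" by (auto simp: G_def)
  ultimately have G[measurable]: "G \<in> sets M" by simp
  have "measure M (space M - G) \<le> block_entropy B n / (real c * ln 2)"
    using measure_small_cylinders[OF B, of "real c * ln 2" n] c0 by (simp add: G_compl exp_c)
  also have "\<dots> \<le> \<delta>"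
  proof -
    have "block_entropy B n \<le> \<delta> * (\<delta> * real n) * ln 2"
      using n(1) n0 by (simp add: field_simps power2_eq_square)
    also have "\<dots> \<le> \<delta> * real c * ln 2"
      using c \<delta> by (intro mult_right_mono mult_left_mono) auto
    finally show ?thesis using c0 by (simp add: field_simps)
  qed
  finally have G_large: "measure M (space M - G) \<le> \<delta>" .
  obtain F where F: "F \<in> sets M" "0 < measure M F" "measure M F < \<delta> / (2 * real n)"
    using small[of "\<delta> / (2 * real n)"] \<delta> n0 by auto
  obtain E where E: "tower_base n E" "E \<subseteq> G"
    "measure M (space M - tower n E) \<le> 2 * real n * measure M F + measure M (space M - G)"
    using tower_base_subset_exists[OF F(1) ergodic_recurrent_to[OF F(1,2) erg] G n0] by blast
  have "2 * real n * measure M F \<le> \<delta>" using F(3) n0 by (simp add: field_simps)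
  then have E': "measure M (space M - tower n E) \<le> 2 * \<delta>" using E(3) G_large by linarith
  have likely: "(1/2) ^ c \<le> measure M (cylinder B n (itinerary B n x))" if "x \<in> E" for x
    using that E(2) by (auto simp: G_def)
  obtain A I F' where A: "A \<in> sets M" "finite I"
    "measure M (sym_diff A A0) \<le>
      measure M (space M - tower n E) + (real m + real n / real m + 2 + real c) / real n"
    "measure M (sym_diff B (window_code A I F')) \<le> measure M (space M - tower n E)"
    using tower_coding[OF A0 B E(1) likely m(1) m0 mcn] by blast
  have "real n / real m \<le> \<delta> * real n"
  proof -
    have "1 / real m \<le> \<delta>" using m(2) m0 \<delta> by (simp add: field_simps)
    then show ?thesis using mult_right_mono[of "1 / real m" \<delta> "real n"] by simp
  qed
  then have "real m + real n / real m + 2 + real c \<le> 3 * \<delta> * real n" using n' c by linarith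
  then have "(real m + real n / real m + 2 + real c) / real n \<le> 3 * \<delta>"
    using n0 by (simp add: field_simps)
  then have "measure M (sym_diff A A0) < \<epsilon>" using A(3) E' \<delta> by linarith
  moreover have "measure M (sym_diff B (window_code A I F')) < \<epsilon>" using A(4) E' \<delta> by linarith
  ultimately show ?thesis using A that by blast
qed

end

section \<open>The measure algebra of a standard probability space\<close>

text \<open>Only the finitely many patterns in \<open>F \<inter> Pow I\<close> can occur. The
  setting is an arbitrary \<sigma>-algebra because the fact is applied both to \<open>sets M\<close>
  and to the one generated by the translates of \<open>A\<close>.\<close>

lemma (in sigma_algebra) sets_Collect_finite_pattern:
  assumes I: "finite I" and Q: "\<And>k. k \<in> I \<Longrightarrow> {x \<in> \<Omega>. Q k x} \<in> M"
  shows "{x \<in> \<Omega>. {k \<in> I. Q k x} \<in> F} \<in> M"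
proof -
  have "{x \<in> \<Omega>. \<exists>s\<in>F \<inter> Pow I. \<forall>k\<in>I. Q k x \<longleftrightarrow> k \<in> s} \<in> M"
  proof (intro sets_Collect_finite_Ex sets_Collect_finite_All)
    fix s k assume "k \<in> I"
    then show "{x \<in> \<Omega>. Q k x \<longleftrightarrow> k \<in> s} \<in> M"
      using Q[of k] sets_Collect_neg[of "Q k"] by (cases "k \<in> s") auto
  qed (use I in auto)
  also have "{x \<in> \<Omega>. \<exists>s\<in>F \<inter> Pow I. \<forall>k\<in>I. Q k x \<longleftrightarrow> k \<in> s} = {x \<in> \<Omega>. {k \<in> I. Q k x} \<in> F}"
  proof -
    have "(\<exists>s\<in>F \<inter> Pow I. \<forall>k\<in>I. Q k x \<longleftrightarrow> k \<in> s) \<longleftrightarrow> {k \<in> I. Q k x} \<in> F" for x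
    proof
      assume "\<exists>s\<in>F \<inter> Pow I. \<forall>k\<in>I. Q k x \<longleftrightarrow> k \<in> s"
      then obtain s where s: "s \<in> F" "s \<subseteq> I" "\<forall>k\<in>I. Q k x \<longleftrightarrow> k \<in> s" by blast
      then have "{k \<in> I. Q k x} = s" by blast
      then show "{k \<in> I. Q k x} \<in> F" using s by simp
    next
      assume "{k \<in> I. Q k x} \<in> F"
      then show "\<exists>s\<in>F \<inter> Pow I. \<forall>k\<in>I. Q k x \<longleftrightarrow> k \<in> s"
        by (intro bexI[of _ "{k \<in> I. Q k x}"]) auto
    qed
    then show ?thesis by simp
  qed
  finally show ?thesis .
qed

section \<open>Completeness of the measure algebra\<close>

context finite_measure
begin

text \<open>A point outside all differences from index \<open>n\<close> on lies in every later
  \<open>A k\<close> or in none, so the limit superior agrees with \<open>A n\<close> there; the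
  differences have total measure at most a geometric tail. The limit is an explicit set, which
  serves both completeness and membership in a generated \<sigma>-algebra.\<close>

lemma measure_sym_diff_limsup_le:
  assumes [measurable]: "\<And>k. A k \<in> sets M"
    and small: "\<And>k. measure M (sym_diff (A k) (A (Suc k))) \<le> (1/2) ^ k"
  shows "measure M (sym_diff (A n) (\<Inter>n. \<Union>k\<in>{n..}. A k)) \<le> 2 * (1/2) ^ n"
proof -
  let ?D = "\<lambda>i. sym_diff (A (i + n)) (A (Suc (i + n)))"
  have sum: "(\<lambda>i. (1/2) ^ (i + n)) sums (2 * (1/2) ^ n :: real)"
    using sums_mult2[OF geometric_sums[of "1/2 :: real"], of "(1/2) ^ n"] by (simp add: power_add)
  have summ: "summable (\<lambda>i. measure M (?D i))"
    using small by (intro summable_comparison_test_ev[OF _ sums_summable[OF sum]]) auto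
  have chain: "x \<in> A (i + n) \<longleftrightarrow> x \<in> A n" if "x \<notin> (\<Union>i. ?D i)" for x i
    using that by (induction i) auto
  have "sym_diff (A n) (\<Inter>n. \<Union>k\<in>{n..}. A k) \<subseteq> (\<Union>i. ?D i)"
  proof (intro subsetI, rule ccontr)
    fix x assume x: "x \<in> sym_diff (A n) (\<Inter>n. \<Union>k\<in>{n..}. A k)" "x \<notin> (\<Union>i. ?D i)"
    have c: "x \<in> A k \<longleftrightarrow> x \<in> A n" if "k \<ge> n" for k
      using chain[OF x(2), of "k - n"] that by simp
    have "x \<in> (\<Inter>n. \<Union>k\<in>{n..}. A k) \<longleftrightarrow> x \<in> A n"
    proof
      assume "x \<in> A n"
      then have "x \<in> A (max j n)" for j using c[of "max j n"] by simp
      then show "x \<in> (\<Inter>n. \<Union>k\<in>{n..}. A k)" by (meson INT_I UN_I atLeast_iff max.cobounded1)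
    qed (use c in blast)
    then show False using x(1) by blast
  qed
  then have "measure M (sym_diff (A n) (\<Inter>n. \<Union>k\<in>{n..}. A k)) \<le> measure M (\<Union>i. ?D i)"
    by (intro finite_measure_mono) auto
  also have "\<dots> \<le> (\<Sum>i. measure M (?D i))"
    using summ by (intro finite_measure_subadditive_countably) auto
  also have "\<dots> \<le> (\<Sum>i. (1/2) ^ (i + n))"
    using small summ sums_summable[OF sum] by (intro suminf_le) auto
  also have "\<dots> = 2 * (1/2) ^ n" using sum by (rule sums_unique[symmetric])
  finally show ?thesis .
qed

lemma null_class_in_measure_algebra:
  "A \<in> sets M \<Longrightarrow> null_equiv M `` {A} \<in> measure_algebra M"
  by (auto simp: measure_algebra_def quotientI)

lemma mem_null_class: "A \<in> sets M \<Longrightarrow> A \<in> null_equiv M `` {A}"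
  by (auto simp: null_equiv_def)

lemma measure_algebra_representative:
  assumes "a \<in> measure_algebra M" obtains A where "A \<in> a" "A \<in> sets M"
  using assms in_quotient_imp_non_empty[OF equiv_null_equiv] in_quotient_imp_subset[OF equiv_null_equiv]
  unfolding measure_algebra_def by blast

lemma measure_algebra_sets: "a \<in> measure_algebra M \<Longrightarrow> A \<in> a \<Longrightarrow> A \<in> sets M"
  using in_quotient_imp_subset[OF equiv_null_equiv] unfolding measure_algebra_def by blast

lemma mcomplete_measure_algebra:
  "Metric_space.mcomplete (measure_algebra M) (measure_algebra_dist M)"
proof -
  interpret MA: Metric_space "measure_algebra M" "measure_algebra_dist M"
    by (rule Metric_space_measure_algebra)
  show ?thesis
    unfolding MA.mcomplete_def
  proof (intro allI impI)
    fix \<sigma> assume \<sigma>: "MA.MCauchy \<sigma>"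
    then have in_alg: "\<sigma> n \<in> measure_algebra M" for n by (auto simp: MA.MCauchy_def)
    have "\<exists>N. \<forall>n n'. N \<le> n \<longrightarrow> N \<le> n' \<longrightarrow> measure_algebra_dist M (\<sigma> n) (\<sigma> n') < (1/2) ^ k" for k
      using \<sigma> by (simp add: MA.MCauchy_def)
    then obtain N where N: "\<And>k n n'. N k \<le> n \<Longrightarrow> N k \<le> n' \<Longrightarrow>
        measure_algebra_dist M (\<sigma> n) (\<sigma> n') < (1/2) ^ k" by metis
    \<comment> \<open>Summing makes the subsequence monotone while keeping it beyond
      \<open>N k\<close>.\<close>
    define r where "r k = (\<Sum>i\<le>k. N i)" for k
    have r: "N k \<le> r k" "r k \<le> r (Suc k)" for k by (auto simp: r_def intro: member_le_sum)
    have "\<exists>A. A \<in> \<sigma> (r k)" for k using measure_algebra_representative[OF in_alg] by blast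
    then obtain A where A: "\<And>k. A k \<in> \<sigma> (r k)" by metis
    have [measurable]: "A k \<in> sets M" for k using measure_algebra_sets[OF in_alg A] .
    let ?L = "\<Inter>n. \<Union>k\<in>{n..}. A k"
    let ?l = "null_equiv M `` {?L}"
    have L: "?L \<in> sets M" by measurable
    have "measure M (sym_diff (A k) (A (Suc k))) \<le> (1/2) ^ k" for k
      using N[of k "r k" "r (Suc k)"] r[of k] measure_algebra_dist_class[OF in_alg in_alg A A]
      by (metis le_trans less_imp_le)
    then have AL: "measure M (sym_diff (A k) ?L) \<le> 2 * (1/2) ^ k" for k
      by (intro measure_sym_diff_limsup_le) auto
    have dist_l: "measure_algebra_dist M (\<sigma> (r k)) ?l \<le> 2 * (1/2) ^ k" for k
      using AL[of k]
      by (subst measure_algebra_dist_class[OF in_alg null_class_in_measure_algebra[OF L] A mem_null_class[OF L]])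
    have "limitin MA.mtopology \<sigma> ?l sequentially"
      unfolding MA.limitin_metric
    proof (intro conjI allI impI null_class_in_measure_algebra[OF L])
      fix e :: real assume "e > 0"
      then obtain k where k: "(1/2) ^ k < e / 3" using real_arch_pow_inv[of "e / 3" "1/2"] by auto
      have "measure_algebra_dist M (\<sigma> n) ?l < e" if "n \<ge> N k" for n
      proof -
        have "measure_algebra_dist M (\<sigma> n) ?l \<le>
            measure_algebra_dist M (\<sigma> n) (\<sigma> (r k)) + measure_algebra_dist M (\<sigma> (r k)) ?l"
          using in_alg null_class_in_measure_algebra[OF L] by (intro MA.triangle)
        then show ?thesis using N[of k n "r k"] r[of k] that dist_l[of k] k by linarith
      qed
      then show "\<forall>\<^sub>F n in sequentially. \<sigma> n \<in> measure_algebra M \<and> measure_algebra_dist M (\<sigma> n) ?l < e"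
        using in_alg by (auto simp: eventually_sequentially)
    qed
    then show "\<exists>l. limitin MA.mtopology \<sigma> l sequentially" by blast
  qed
qed

section \<open>The closure of a family of sets in measure\<close>

definition approximable_by :: "'a set set \<Rightarrow> 'a set \<Rightarrow> bool" where
  "approximable_by D A \<longleftrightarrow> A \<in> sets M \<and> (\<forall>e>0. \<exists>B\<in>D. measure M (sym_diff A B) < e)"

lemma approximable_by_subset: "D \<subseteq> sets M \<Longrightarrow> A \<in> D \<Longrightarrow> approximable_by D A"
  by (auto simp: approximable_by_def intro!: bexI[of _ A])

lemma approximable_by_approximable:
  assumes D: "D \<subseteq> sets M" and A: "A \<in> sets M"
    and "\<And>e. e > 0 \<Longrightarrow> \<exists>B. approximable_by D B \<and> measure M (sym_diff A B) < e"
  shows "approximable_by D A"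
  unfolding approximable_by_def
proof (intro conjI A allI impI)
  fix e :: real assume "e > 0"
  then obtain B where B: "approximable_by D B" "measure M (sym_diff A B) < e / 2"
    using assms(3)[of "e / 2"] by auto
  then obtain C where C: "C \<in> D" "measure M (sym_diff B C) < e / 2"
    using \<open>e > 0\<close> unfolding approximable_by_def by (meson half_gt_zero)
  have "measure M (sym_diff A C) < e"
    using measure_sym_diff_triangle[of A B C] A B C D by (auto simp: approximable_by_def)
  then show "\<exists>B\<in>D. measure M (sym_diff A B) < e" using C by blast
qed

lemma approximable_by_Un:
  assumes D: "D \<subseteq> sets M" "\<And>A B. A \<in> D \<Longrightarrow> B \<in> D \<Longrightarrow> A \<union> B \<in> D"
    and A: "approximable_by D A" and B: "approximable_by D B"
  shows "approximable_by D (A \<union> B)"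
  unfolding approximable_by_def
proof (intro conjI allI impI)
  have [measurable]: "A \<in> sets M" "B \<in> sets M" using A B by (auto simp: approximable_by_def)
  show "A \<union> B \<in> sets M" by measurable
  fix e :: real assume "e > 0"
  then obtain A' B' where *: "A' \<in> D" "measure M (sym_diff A A') < e / 2" "B' \<in> D"
    "measure M (sym_diff B B') < e / 2"
    using A B unfolding approximable_by_def by (meson half_gt_zero)
  have [measurable]: "A' \<in> sets M" "B' \<in> sets M" using * D by auto
  have "measure M (sym_diff (A \<union> B) (A' \<union> B')) \<le> measure M (sym_diff A A' \<union> sym_diff B B')"
    by (intro finite_measure_mono) auto
  also have "\<dots> \<le> measure M (sym_diff A A') + measure M (sym_diff B B')"
    by (intro measure_Un_le) auto
  finally have "measure M (sym_diff (A \<union> B) (A' \<union> B')) < e" using * by linarith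
  then show "\<exists>C\<in>D. measure M (sym_diff (A \<union> B) C) < e" using * D by blast
qed

lemma approximable_by_Compl:
  assumes D: "D \<subseteq> sets M" "\<And>A. A \<in> D \<Longrightarrow> space M - A \<in> D" and A: "approximable_by D A"
  shows "approximable_by D (space M - A)"
  unfolding approximable_by_def
proof (intro conjI allI impI)
  have A_sets: "A \<in> sets M" using A by (auto simp: approximable_by_def)
  then show "space M - A \<in> sets M" by auto
  fix e :: real assume "e > 0"
  then obtain B where B: "B \<in> D" "measure M (sym_diff A B) < e"
    using A unfolding approximable_by_def by blast
  have "sym_diff (space M - A) (space M - B) = sym_diff A B"
    using A_sets B D sets.sets_into_space by blast
  then show "\<exists>C\<in>D. measure M (sym_diff (space M - A) C) < e" using B D by metis
qed

text \<open>Finite unions exhaust the countable one in measure by continuity from below, and a limit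
  of approximable sets is approximable.\<close>

lemma approximable_by_UN:
  assumes D: "D \<subseteq> sets M" "{} \<in> D" "\<And>A B. A \<in> D \<Longrightarrow> B \<in> D \<Longrightarrow> A \<union> B \<in> D"
    and A: "\<And>n::nat. approximable_by D (A n)"
  shows "approximable_by D (\<Union>n. A n)"
proof (rule approximable_by_approximable[OF D(1)])
  have [measurable]: "A n \<in> sets M" for n using A by (auto simp: approximable_by_def)
  show "(\<Union>n. A n) \<in> sets M" by measurable
  fix e :: real assume e: "e > 0"
  have fin: "approximable_by D (\<Union>i<n. A i)" for n
  proof (induction n)
    case 0
    show ?case using approximable_by_subset[OF D(1,2)] by simp
  next
    case (Suc n)
    then show ?case using approximable_by_Un[OF D(1,3) A Suc] by (simp add: lessThan_Suc)
  qed
  have lim: "(\<lambda>n. measure M (\<Union>i<n. A i)) \<longlonglongrightarrow> measure M (\<Union>n. \<Union>i<n. A i)"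
    by (intro finite_Lim_measure_incseq) (auto simp: incseq_def, force)
  have eq: "(\<Union>n. \<Union>i<n. A i) = (\<Union>n. A n)" 
  proof (intro equalityI UN_least)
    fix n
    show "A n \<subseteq> (\<Union>n. \<Union>i<n. A i)" by (rule order.trans[OF _ UN_upper[of "Suc n"]]) auto
  qed auto
  have "\<forall>\<^sub>F n in sequentially. measure M (\<Union>n. A n) - e < measure M (\<Union>i<n. A i)"
    using e by (intro order_tendstoD(1)[OF lim]) (simp add: eq)
  then obtain n where n: "measure M (\<Union>n. A n) - e < measure M (\<Union>i<n. A i)"
    by (auto simp: eventually_sequentially)
  have sub: "(\<Union>i<n. A i) \<subseteq> (\<Union>n. A n)" by blast
  then have diff: "sym_diff (\<Union>n. A n) (\<Union>i<n. A i) = (\<Union>n. A n) - (\<Union>i<n. A i)" by blast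
  have "measure M (sym_diff (\<Union>n. A n) (\<Union>i<n. A i)) = measure M (\<Union>n. A n) - measure M (\<Union>i<n. A i)"
    unfolding diff by (intro finite_measure_Diff sub) measurable
  with n have "measure M (sym_diff (\<Union>n. A n) (\<Union>i<n. A i)) < e" by linarith
  with fin show "\<exists>B. approximable_by D B \<and> measure M (sym_diff (\<Union>n. A n) B) < e" by blast
qed

end

lemma standard_probability_spaceE:
  assumes "standard_probability_space M"
  obtains X where "prob_space M" "completely_metrizable_space X" "second_countable X"
    "topspace X = space M" "sigma_sets (space M) {U. openin X U} \<subseteq> sets M"
    "\<forall>A\<in>sets M. \<exists>B\<in>sigma_sets (space M) {U. openin X U}.
      \<exists>C\<in>sigma_sets (space M) {U. openin X U}. B \<subseteq> A \<and> A \<subseteq> C \<and> measure M (C - B) = 0"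
  using assms unfolding standard_probability_space_def by (elim conjE exE) (rule that)

text \<open>The algebra \<open>D\<close> generated by a countable base is countable. Its closure in
  measure is a \<sigma>-algebra containing the open sets, hence all Borel sets, and each measurable
  set differs from a Borel set by a null set.\<close>

lemma standard_probability_space_separable:
  assumes std: "standard_probability_space M"
  obtains D where "countable D" "D \<subseteq> sets M"
    "\<And>A e. A \<in> sets M \<Longrightarrow> e > 0 \<Longrightarrow> \<exists>B\<in>D. measure M (sym_diff A B) < e"
proof -
  obtain X where "prob_space M" and X: "second_countable X" "topspace X = space M"
      "sigma_sets (space M) {U. openin X U} \<subseteq> sets M"
    and compl: "\<forall>A\<in>sets M. \<exists>B\<in>sigma_sets (space M) {U. openin X U}.
      \<exists>C\<in>sigma_sets (space M) {U. openin X U}. B \<subseteq> A \<and> A \<subseteq> C \<and> measure M (C - B) = 0"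
    using std by (rule standard_probability_spaceE)
  then interpret prob_space M by simp
  obtain \<B> where \<B>_countable: "countable \<B>" and \<B>_open: "\<forall>V\<in>\<B>. openin X V"
    and \<B>_basis: "\<forall>U x. openin X U \<and> x \<in> U \<longrightarrow> (\<exists>V\<in>\<B>. x \<in> V \<and> V \<subseteq> U)"
    using X(1) unfolding second_countable_def by (elim exE conjE) (rule that)
  \<comment> \<open>A member of the generated algebra is decided by which of finitely many base sets
    contain the point. In this form countability is a matter of counting indices, and the Boolean
    operations act on patterns.\<close>
  define code where "code = (\<lambda>(\<I>, F). {x \<in> space M. {V \<in> \<I>. x \<in> V} \<in> F})"
  let ?Fin = "{\<I>. finite \<I> \<and> \<I> \<subseteq> \<B>}"
  let ?Idx = "Sigma ?Fin (\<lambda>\<I>. Pow (Pow \<I>))"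
  define D where "D = code ` ?Idx"
  have cD: "countable D"
    unfolding D_def
    by (intro countable_image countable_SIGMA countable_Collect_finite_subset \<B>_countable)
       (auto intro: countable_finite)
  have \<B>_sets: "V \<in> sets M" if "V \<in> \<B>" for V
    using \<B>_open that X(3) by (auto intro: sigma_sets.Basic)
  have D_sets: "D \<subseteq> sets M"
  proof
    fix A assume "A \<in> D"
    then obtain \<I> F where A: "A = {x \<in> space M. {V \<in> \<I>. x \<in> V} \<in> F}" "finite \<I>" "\<I> \<subseteq> \<B>"
      by (auto simp: D_def code_def)
    show "A \<in> sets M"
      unfolding A(1) using A \<B>_sets by (intro sets.sets_Collect_finite_pattern) auto
  qed
  have D_empty: "{} \<in> D"
    unfolding D_def by (intro image_eqI[of _ _ "({}, {})"]) (auto simp: code_def)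
  have D_basis: "V \<in> D" if V: "V \<in> \<B>" for V
    unfolding D_def using V openin_subset[OF bspec[OF \<B>_open V]] X(2)
    by (intro image_eqI[of _ _ "({V}, {{V}})"]) (auto simp: code_def)
  have D_Compl: "space M - A \<in> D" if "A \<in> D" for A
  proof -
    from that obtain \<I> F where A: "A = code (\<I>, F)" "finite \<I>" "\<I> \<subseteq> \<B>"
      by (auto simp: D_def)
    have "space M - A = code (\<I>, Pow \<I> - F)" unfolding A by (auto simp: code_def)
    then show ?thesis unfolding D_def using A by auto
  qed
  have D_Un: "A \<union> B \<in> D" if "A \<in> D" "B \<in> D" for A B
  proof -
    from that obtain \<I> F \<J> G where A: "A = code (\<I>, F)" "finite \<I>" "\<I> \<subseteq> \<B>"
      and B: "B = code (\<J>, G)" "finite \<J>" "\<J> \<subseteq> \<B>"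
      by (auto simp: D_def)
    have "{V \<in> \<I> \<union> \<J>. x \<in> V} \<inter> \<I> = {V \<in> \<I>. x \<in> V}" "{V \<in> \<I> \<union> \<J>. x \<in> V} \<inter> \<J> = {V \<in> \<J>. x \<in> V}" for x
      by auto
    then have "A \<union> B = code (\<I> \<union> \<J>, {s \<in> Pow (\<I> \<union> \<J>). s \<inter> \<I> \<in> F \<or> s \<inter> \<J> \<in> G})"
      unfolding A B by (auto simp: code_def)
    then show ?thesis unfolding D_def using A B by (intro image_eqI) auto
  qed
  note UN = approximable_by_UN[OF D_sets D_empty D_Un]
  have borel: "approximable_by D A" if "A \<in> sigma_sets (space M) {U. openin X U}" for A
    using that
  proof induction
    case (Basic U)
    \<comment> \<open>The empty set is added because \<open>from_nat_into\<close> enumerates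
      nonempty sets, while \<open>U\<close> may contain no base set.\<close>
    let ?B = "insert {} {V \<in> \<B>. V \<subseteq> U}"
    have cB: "countable ?B" using \<B>_countable by simp
    have "U \<subseteq> \<Union>?B"
    proof
      fix x assume "x \<in> U"
      then obtain V where "V \<in> \<B>" "x \<in> V" "V \<subseteq> U" using \<B>_basis Basic by fast
      then show "x \<in> \<Union>?B" by blast
    qed
    then have "U = \<Union>?B" by blast
    also have "\<dots> = (\<Union>n. from_nat_into ?B n)" by (subst range_from_nat_into[OF _ cB]) auto
    also have "approximable_by D \<dots>"
    proof (rule UN)
      fix n
      have "?B \<subseteq> D" using D_empty by (auto intro: D_basis)
      then have "from_nat_into ?B n \<in> D" by (rule subsetD) (rule from_nat_into[OF insert_not_empty])
      then show "approximable_by D (from_nat_into ?B n)" by (rule approximable_by_subset[OF D_sets])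
    qed
    finally show ?case .
  next
    case (Compl A)
    then show ?case using approximable_by_Compl[OF D_sets D_Compl] by blast
  qed (auto intro: UN approximable_by_subset[OF D_sets D_empty])
  have "\<exists>B\<in>D. measure M (sym_diff A B) < e" if A: "A \<in> sets M" and "e > 0" for A e
  proof -
    obtain B C where BC: "B \<in> sigma_sets (space M) {U. openin X U}" "C \<in> sigma_sets (space M) {U. openin X U}"
      "B \<subseteq> A" "A \<subseteq> C" "measure M (C - B) = 0" using bspec[OF compl A] by blast
    have "measure M (sym_diff A B) \<le> measure M (C - B)"
      using BC X(3) by (intro finite_measure_mono) auto
    then have "measure M (sym_diff A B) < d" if "d > 0" for d using BC(5) that by linarith
    then have "approximable_by D A"
      using borel[OF BC(1)] by (intro approximable_by_approximable[OF D_sets A]) blast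
    then show ?thesis using \<open>e > 0\<close> by (simp add: approximable_by_def)
  qed
  then show ?thesis using that cD D_sets by blast
qed

section \<open>Generic generators\<close>

text \<open>\<open>int_iterate\<close> is defined by the sign of the exponent. The one-step rules
  \<open>up\<close> and \<open>down\<close> hide this distinction, and the group law, measurability
  and invariance follow by induction on integers in both directions.\<close>

lemma measure_preserving_action_int_iterate:
  assumes "prob_space M" and "invertible_measure_preserving M T"
  shows "measure_preserving_action M (int_iterate M T)"
proof -
  interpret prob_space M by fact
  define S where "S = the_inv_into (space M) T"
  have bij: "bij_betw T (space M) (space M)" and T[measurable]: "T \<in> measurable M M"
    and S[measurable]: "S \<in> measurable M M" and distr: "distr M M T = M"
    using assms(2) by (auto simp: invertible_measure_preserving_def S_def)
  have ST: "S (T x) = x" and TS: "T (S x) = x" if "x \<in> space M" for x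
    using that bij f_the_inv_into_f_bij_betw[OF bij] the_inv_into_f_f[of T "space M" x]
    by (auto simp: S_def bij_betw_def)
  have pow_space: "(T ^^ n) x \<in> space M" "(S ^^ n) x \<in> space M" if "x \<in> space M" for n x
    using that measurable_space[OF T] measurable_space[OF S] by (induction n) auto
  let ?U = "int_iterate M T"
  have up: "?U (a + 1) x = T (?U a x)" if x: "x \<in> space M" for a x
  proof (cases "a \<ge> 0")
    case True
    then show ?thesis by (simp add: int_iterate_def nat_add_distrib)
  next
    case False
    then have "a = - int (Suc (nat (- a) - 1))" by simp
    then obtain k where k: "a = - int (Suc k)" by blast
    then have "?U a x = S ((S ^^ k) x)"
      by (simp add: int_iterate_def S_def[symmetric] nat_add_distrib)
    \<comment> \<open>For \<open>k = 0\<close> the exponent becomes 0, where the definition passes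
      from powers of the inverse to powers of \<open>T\<close>.\<close>
    moreover have "?U (a + 1) x = (S ^^ k) x"
      unfolding k by (cases "k = 0") (simp_all add: int_iterate_def S_def[symmetric])
    ultimately show ?thesis using TS[OF pow_space(2)[OF x, of k]] by simp
  qed
  have U_space: "?U a x \<in> space M" if "x \<in> space M" for a x
    using pow_space that by (auto simp: int_iterate_def S_def[symmetric])
  have down: "?U (a - 1) x = S (?U a x)" if x: "x \<in> space M" for a x
    using up[OF x, of "a - 1"] ST[OF U_space[OF x, of "a - 1"]] by simp
  have zero: "?U 0 x = x" for x by (simp add: int_iterate_def)
  have pres_T: "measure M (T -` A \<inter> space M) = measure M A" if "A \<in> sets M" for A
    using measure_distr[OF T that] distr by simp
  have pres_S: "measure M (S -` A \<inter> space M) = measure M A" if A: "A \<in> sets M" for A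
  proof -
    have "T -` (S -` A \<inter> space M) \<inter> space M = A"
      using sets.sets_into_space[OF A] measurable_space[OF T] by (auto simp: ST)
    then show ?thesis using pres_T[of "S -` A \<inter> space M"] measurable_sets[OF S A] by simp
  qed
  have both: "?U k \<in> measurable M M \<and> (\<forall>A\<in>sets M. measure M (?U k -` A \<inter> space M) = measure M A)" for k
  proof (induction k rule: int_induct[of _ 0])
    case base
    have "?U 0 = id" by (auto simp: zero)
    then show ?case using sets.sets_into_space by (auto simp: Int_absorb2)
  next
    case (step1 i)
    then have meas[measurable]: "?U i \<in> measurable M M" by simp
    have "?U (i + 1) \<in> measurable M M"
      by (subst measurable_cong[OF up]) measurable
    moreover have "measure M (?U (i + 1) -` A \<inter> space M) = measure M A" if A: "A \<in> sets M" for A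
    proof -
      have "?U (i + 1) -` A \<inter> space M = ?U i -` (T -` A \<inter> space M) \<inter> space M"
        using up[of _ i] U_space by auto
      then have "measure M (?U (i + 1) -` A \<inter> space M) = measure M (T -` A \<inter> space M)"
        using step1 measurable_sets[OF T A] by (simp only:)
      then show ?thesis using pres_T[OF A] by simp
    qed
    ultimately show ?case by blast
  next
    case (step2 i)
    then have meas[measurable]: "?U i \<in> measurable M M" by simp
    have "?U (i - 1) \<in> measurable M M"
      by (subst measurable_cong[OF down]) measurable
    moreover have "measure M (?U (i - 1) -` A \<inter> space M) = measure M A" if A: "A \<in> sets M" for A
    proof -
      have "?U (i - 1) -` A \<inter> space M = ?U i -` (S -` A \<inter> space M) \<inter> space M"
        using down[of _ i] U_space by auto
      then have "measure M (?U (i - 1) -` A \<inter> space M) = measure M (S -` A \<inter> space M)"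
        using step2 measurable_sets[OF S A] by (simp only:)
      then show ?thesis using pres_S[OF A] by simp
    qed
    ultimately show ?case by blast
  qed
  have add: "?U a (?U b x) = ?U (a + b) x" if x: "x \<in> space M" for a b x
  proof (induction a rule: int_induct[of _ 0])
    case (step1 i)
    then show ?case using up[OF U_space[OF x], of i b] up[OF x, of "i + b"] by (simp add: algebra_simps)
  next
    case (step2 i)
    then show ?case using down[OF U_space[OF x], of i b] down[OF x, of "i + b"] by (simp add: algebra_simps)
  qed (simp add: zero)
  show ?thesis
    by unfold_locales (use both zero add in auto)
qed

section \<open>Continuity of window codes and a criterion for generators\<close>

context measure_preserving_action
begin

lemma window_code_in_sigma_sets:
  assumes A: "A \<in> sets M" and I: "finite I"
  shows "window_code A I F \<in> sigma_sets (space M) (\<Union>n. partition_vimage M (U n) {A, space M - A})"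
    (is "_ \<in> sigma_sets _ ?G")
proof -
  interpret S: sigma_algebra "space M" "sigma_sets (space M) ?G"
    by (rule sigma_algebra_sigma_sets) (auto simp: partition_vimage_def)
  have "{x \<in> space M. U k x \<in> A} \<in> sigma_sets (space M) ?G" for k
  proof -
    have "{x \<in> space M. U k x \<in> A} = U k -` A \<inter> space M" by auto
    also have "\<dots> \<in> ?G"
      by (rule UN_I[OF UNIV_I]) (unfold partition_vimage_def, rule imageI[OF insertI1])
    finally show ?thesis by (rule sigma_sets.Basic)
  qed
  then show ?thesis unfolding window_code_def by (intro S.sets_Collect_finite_pattern I)
qed

lemma sets_window_code:
  assumes [measurable]: "A \<in> sets M" and I: "finite I" shows "window_code A I F \<in> sets M"
  unfolding window_code_def by (intro sets.sets_Collect_finite_pattern I) measurable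

text \<open>The codes can disagree at \<open>x\<close> only if some \<open>U k x\<close> with
  \<open>k\<close> in the window hits the difference of \<open>A\<close> and \<open>A'\<close>. This
  Lipschitz bound yields openness, and it shows that null changes of \<open>A\<close> do not
  matter.\<close>

lemma measure_sym_diff_window_code_le:
  assumes [measurable]: "A \<in> sets M" "A' \<in> sets M" and I: "finite I"
  shows "measure M (sym_diff (window_code A I F) (window_code A' I F)) \<le>
    real (card I) * measure M (sym_diff A A')"
proof -
  have "sym_diff (window_code A I F) (window_code A' I F) \<subseteq>
      {x \<in> space M. \<exists>k\<in>I. U k x \<in> sym_diff A A'}"
  proof
    fix x assume x: "x \<in> sym_diff (window_code A I F) (window_code A' I F)"
    then have "{k \<in> I. U k x \<in> A} \<noteq> {k \<in> I. U k x \<in> A'}" by (auto simp: window_code_def)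
    then show "x \<in> {x \<in> space M. \<exists>k\<in>I. U k x \<in> sym_diff A A'}"
      using x by (auto simp: window_code_def)
  qed
  then have "measure M (sym_diff (window_code A I F) (window_code A' I F)) \<le>
      measure M {x \<in> space M. \<exists>k\<in>I. U k x \<in> sym_diff A A'}"
    using I by (intro finite_measure_mono sets.sets_Collect_finite_Ex) measurable
  also have "\<dots> \<le> real (card I) * measure M (sym_diff A A')"
    using I by (intro measure_Union_action_le) auto
  finally show ?thesis .
qed

text \<open>\<open>generator\<close> demands one set of the generated \<sigma>-algebra that equals
  \<open>B\<close> up to a null set. The limit superior of ever better codes is such a set.\<close>

lemma generator_if_window_codes_dense:
  assumes A: "A \<in> sets M" and U: "U = int_iterate M T"
    and dense: "\<And>B e. B \<in> sets M \<Longrightarrow> e > 0 \<Longrightarrow>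
      \<exists>I F. finite I \<and> measure M (sym_diff B (window_code A I F)) < e"
  shows "generator M T {A, space M - A}"
  unfolding generator_def U[symmetric]
proof (intro conjI ballI)
  show "finite_partition M {A, space M - A}"
    using sets.sets_into_space[OF A] A by (auto simp: finite_partition_def disjoint_def)
  let ?\<Sigma> = "sigma_sets (space M) (\<Union>n. partition_vimage M (U n) {A, space M - A})"
  interpret S: sigma_algebra "space M" ?\<Sigma>
    by (rule sigma_algebra_sigma_sets) (auto simp: partition_vimage_def)
  fix B assume B: "B \<in> sets M"
  \<comment> \<open>The exponent \<open>Suc k\<close> brings consecutive codes within
    \<open>(1/2) ^ k\<close> of each other, as \<open>measure_sym_diff_limsup_le\<close>
    requires.\<close>
  have "\<exists>C. C \<in> ?\<Sigma> \<and> C \<in> sets M \<and> measure M (sym_diff B C) < (1/2) ^ Suc k" for k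
  proof -
    obtain I F where "finite I" "measure M (sym_diff B (window_code A I F)) < (1/2) ^ Suc k"
      using dense[OF B, of "(1/2) ^ Suc k"] by auto
    then show ?thesis
      using window_code_in_sigma_sets[OF A, of I F] sets_window_code[OF A, of I F]
      by (intro exI[of _ "window_code A I F"]) simp
  qed
  then obtain C where C: "\<And>k. C k \<in> ?\<Sigma>" "\<And>k. C k \<in> sets M"
    "\<And>k. measure M (sym_diff B (C k)) < (1/2) ^ Suc k" by metis
  let ?L = "\<Inter>n. \<Union>k\<in>{n..}. C k"
  have L: "?L \<in> ?\<Sigma>" 
  proof (rule S.countable_INT)
    have "(\<Union>k\<in>{n..}. C k) \<in> ?\<Sigma>" for n
      by (rule S.countable_UN) (use C(1) in blast)
    then show "range (\<lambda>n. \<Union>k\<in>{n..}. C k) \<subseteq> ?\<Sigma>" by blast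
  qed simp
  have L_sets: "?L \<in> sets M" using C(2) by measurable
  have step: "measure M (sym_diff (C k) (C (Suc k))) \<le> (1/2) ^ k" for k
  proof -
    have "measure M (sym_diff (C k) (C (Suc k))) \<le>
        measure M (sym_diff B (C k)) + measure M (sym_diff B (C (Suc k)))"
      using measure_sym_diff_triangle[OF C(2) B C(2), of k "Suc k"] by (simp add: Un_commute)
    also have "\<dots> \<le> (1/2) ^ Suc k + (1/2) ^ Suc (Suc k)"
      using C(3)[of k] C(3)[of "Suc k"] by linarith
    also have "\<dots> \<le> (1/2) ^ k" by simp
    finally show ?thesis .
  qed
  have bound: "measure M (sym_diff B ?L) \<le> 3 * (1/2) ^ k" for k
    using zero_le_power[of "1/2 :: real" k] measure_sym_diff_triangle[OF B C(2)[of k] L_sets] C(3)[of k, unfolded power_Suc]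
      measure_sym_diff_limsup_le[OF C(2) step, of k] by linarith
  have "(\<lambda>k. 3 * (1/2) ^ k :: real) \<longlonglongrightarrow> 3 * 0"
    by (intro tendsto_mult_left LIMSEQ_power_zero) simp
  then have "measure M (sym_diff B ?L) \<le> 3 * 0"
    by (rule LIMSEQ_le_const) (use bound in blast)
  then have "measure M (sym_diff B ?L) = 0" by (simp add: measure_le_0_iff)
  then show "\<exists>C\<in>?\<Sigma>. measure M (sym_diff B C) = 0" using L by blast
qed

text \<open>An atom that is not periodic would be the base of towers of every height, so its mass
  would be at most \<open>1 / n\<close> for all \<open>n\<close>. A periodic one lies in the null
  set of periodic points.\<close>

lemma measure_singleton_eq_zero:
  assumes x: "{x} \<in> sets M" and U: "\<And>n. U (int n) = T ^^ n" and "aperiodic M T"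
  shows "measure M {x} = 0"
proof (rule ccontr)
  assume "measure M {x} \<noteq> 0"
  then have pos: "measure M {x} > 0" by (simp add: zero_less_measure_iff)
  have xs: "x \<in> space M" using sets.sets_into_space[OF x] by simp
  have "\<exists>n>0. (T ^^ n) x = x"
  proof (rule ccontr)
    assume no: "\<not> ?thesis"
    have "tower_base n {x}" for n
    proof -
      have *: False if "a < b" "U (int a) x = U (int b) x" for a b
      proof -
        have "U (- int a) (U (int a) x) = U (- int a) (U (int b) x)" using that by simp
        then have "x = U (- int a + int b) x" using xs by (simp add: action_add action_zero)
        also have "- int a + int b = int (b - a)" using that by simp
        finally show False using no that by (metis U zero_less_diff)
      qed
      then show ?thesis unfolding tower_base_def using x by (auto, metis linorder_neqE_nat)
    qed
    then have "real n * measure M {x} \<le> 1" for n by (rule measure_tower_base)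
    moreover obtain n :: nat where "1 / measure M {x} < real n" using reals_Archimedean2 by blast
    ultimately show False using pos by (simp add: field_simps) (meson linorder_not_less)
  qed
  then have "{x} \<subseteq> {x \<in> space M. \<exists>n>0. (T ^^ n) x = x}" using xs by simp
  then have "{x} \<in> null_sets M"
    using assms(3) x null_sets_subset unfolding aperiodic_def by blast
  then show False using pos by (simp add: measure_eq_0_null_sets)
qed

text \<open>Balls shrinking to a point have measures tending to 0, so each point has a basic
  neighbourhood of measure below \<open>e\<close>. If all of these were null, countably many null
  sets would cover the space.\<close>

lemma small_sets_exist:
  assumes std: "standard_probability_space M" and null: "\<And>x. {x} \<in> sets M \<Longrightarrow> measure M {x} = 0"
    and e: "e > 0"
  shows "\<exists>F\<in>sets M. 0 < measure M F \<and> measure M F < e"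
proof (rule ccontr)
  assume no: "\<not> ?thesis"
  obtain X where cm: "completely_metrizable_space X" and sc: "second_countable X"
      and space_X: "topspace X = space M" and open_sets: "sigma_sets (space M) {U. openin X U} \<subseteq> sets M"
    using std by (rule standard_probability_spaceE)
  obtain \<B> where \<B>_countable: "countable \<B>" and \<B>_open: "\<forall>V\<in>\<B>. openin X V"
    and \<B>_basis: "\<forall>U x. openin X U \<and> x \<in> U \<longrightarrow> (\<exists>V\<in>\<B>. x \<in> V \<and> V \<subseteq> U)"
    using sc unfolding second_countable_def by (elim exE conjE) (rule that)
  obtain S d where "Metric_space S d" and X: "X = Metric_space.mtopology S d"
    using cm unfolding completely_metrizable_space_def by blast
  then interpret Metric_space S d by simp
  have S: "S = space M" using space_X X by simp
  have sets_open: "V \<in> sets M" if "openin X V" for V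
    using that open_sets by (auto intro: sigma_sets.Basic)
  let ?\<V> = "{V \<in> \<B>. measure M V < e}"
  have "space M \<subseteq> \<Union>?\<V>"
  proof
    fix x assume x: "x \<in> space M"
    let ?b = "\<lambda>n. mball x (1 / real (Suc n))"
    have balls: "?b n \<in> sets M" for n by (intro sets_open) (simp add: X)
    have "decseq ?b"
      unfolding decseq_def by (intro allI impI mball_subset_concentric divide_left_mono) auto
    then have "(\<lambda>n. measure M (?b n)) \<longlonglongrightarrow> measure M (\<Inter>n. ?b n)"
      using balls by (intro finite_Lim_measure_decseq) auto
    also have singleton: "(\<Inter>n. ?b n) = {x}"
    proof -
      have "y = x" if y: "\<And>n. y \<in> ?b n" for y
      proof (rule ccontr)
        assume "y \<noteq> x"
        then have "d x y > 0" using y[of 0] by (auto simp: mdist_pos_less)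
        then obtain n where "1 / real (Suc n) < d x y" using nat_approx_posE by blast
        then show False using y[of n] by simp
      qed
      moreover have "x \<in> ?b n" for n using x by (simp add: S[symmetric])
      ultimately show ?thesis by blast
    qed
    also have "measure M {x} = 0"
    proof (rule null)
      have "(\<Inter>n. ?b n) \<in> sets M" using balls by (intro sets.countable_INT) auto
      then show "{x} \<in> sets M" unfolding singleton .
    qed
    finally have "(\<lambda>n. measure M (?b n)) \<longlonglongrightarrow> 0" .
    then have "\<forall>\<^sub>F n in sequentially. measure M (?b n) < e" using e by (rule order_tendstoD(2))
    then obtain n where n: "measure M (?b n) < e" by (auto simp: eventually_sequentially)
    have "openin X (?b n)" "x \<in> ?b n" using x by (simp_all add: X S[symmetric])
    then obtain V where V: "V \<in> \<B>" "x \<in> V" "V \<subseteq> ?b n" using \<B>_basis by meson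
    have "measure M V \<le> measure M (?b n)" using V balls by (intro finite_measure_mono)
    then show "x \<in> \<Union>?\<V>" using V n by auto
  qed
  moreover have null_cover: "(\<Union>V\<in>?\<V>. V) \<in> null_sets M"
  proof (rule null_sets_UN')
    show "countable ?\<V>" using \<B>_countable by simp
    fix V assume V: "V \<in> ?\<V>"
    then have "V \<in> sets M" using \<B>_open by (intro sets_open) simp
    moreover have "measure M V = 0"
    proof (rule ccontr)
      assume "measure M V \<noteq> 0"
      then have "0 < measure M V" by (simp add: zero_less_measure_iff)
      then show False using no V \<open>V \<in> sets M\<close> by blast
    qed
    ultimately show "V \<in> null_sets M" by (simp add: emeasure_eq_measure null_sets_def)
  qed
  ultimately have "space M \<in> null_sets M"
    by (intro null_sets_subset[OF null_cover sets.top]) simp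
  then have "measure M (space M) = 0" by (rule measure_eq_0_null_sets)
  then show False using prob_space by simp
qed

text \<open>Asking this of one member of the class is enough: another member differs by a null set,
  and so do its codes.\<close>

definition encoding :: "'a set \<Rightarrow> real \<Rightarrow> 'a set set set" where
  "encoding B e = {a \<in> measure_algebra M. \<exists>A\<in>a. \<exists>I F. finite I \<and> measure M (sym_diff B (window_code A I F)) < e}"

lemma openin_encoding:
  assumes B: "B \<in> sets M"
  shows "openin (measure_algebra_topology M) (encoding B e)"
proof -
  interpret MA: Metric_space "measure_algebra M" "measure_algebra_dist M"
    by (rule Metric_space_measure_algebra)
  show ?thesis
    unfolding measure_algebra_topology_def MA.openin_mtopology
  proof (intro conjI allI impI)
    show "encoding B e \<subseteq> measure_algebra M" by (auto simp: encoding_def)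
    fix a assume "a \<in> encoding B e"
    then obtain A I F where a: "a \<in> measure_algebra M" and A: "A \<in> a" and I: "finite I"
      and less: "measure M (sym_diff B (window_code A I F)) < e" by (auto simp: encoding_def)
    have A_sets: "A \<in> sets M" using a A by (rule measure_algebra_sets)
    \<comment> \<open>Nearby sets keep the same window and patterns. This radius spreads the slack
      over the window; the summand 1 covers the empty window.\<close>
    define r where "r = (e - measure M (sym_diff B (window_code A I F))) / (real (card I) + 1)"
    have r: "r > 0" using less by (simp add: r_def)
    have "MA.mball a r \<subseteq> encoding B e"
    proof
      fix b assume b: "b \<in> MA.mball a r"
      then have b_alg: "b \<in> measure_algebra M" and dist: "measure_algebra_dist M a b < r" by auto
      obtain A' where A': "A' \<in> b" "A' \<in> sets M" using measure_algebra_representative[OF b_alg] by blast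
      have "measure M (sym_diff A A') < r"
        using dist measure_algebra_dist_class[OF a b_alg A A'(1)] by simp
      then have "(real (card I) + 1) * measure M (sym_diff A A') < (real (card I) + 1) * r"
        by (intro mult_strict_left_mono) auto
      also have "\<dots> = e - measure M (sym_diff B (window_code A I F))" by (simp add: r_def)
      finally have small: "real (card I) * measure M (sym_diff A A') < e - measure M (sym_diff B (window_code A I F))"
        using measure_nonneg[of M "sym_diff A A'"] by (simp add: algebra_simps del: measure_nonneg)
      have "measure M (sym_diff B (window_code A' I F)) \<le>
          measure M (sym_diff B (window_code A I F)) +
          measure M (sym_diff (window_code A I F) (window_code A' I F))"
        by (intro measure_sym_diff_triangle B sets_window_code A_sets A' I)
      also have "\<dots> < e"
        using measure_sym_diff_window_code_le[OF A_sets A'(2) I, of F] small by linarith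
      finally show "b \<in> encoding B e" using b_alg A'(1) I by (auto simp: encoding_def)
    qed
    with r show "\<exists>r>0. MA.mball a r \<subseteq> encoding B e" by blast
  qed
qed

lemma closure_of_encoding:
  assumes "ergodic M (U 1)"
    and "\<And>e. e > 0 \<Longrightarrow> \<exists>F\<in>sets M. 0 < measure M F \<and> measure M F < e"
    and "\<And>e. e > 0 \<Longrightarrow> \<forall>\<^sub>F n in sequentially. block_entropy B n / real n < e"
    and B: "B \<in> sets M" and e: "e > 0"
  shows "measure_algebra_topology M closure_of encoding B e = measure_algebra M"
proof -
  interpret MA: Metric_space "measure_algebra M" "measure_algebra_dist M"
    by (rule Metric_space_measure_algebra)
  have "\<exists>b\<in>encoding B e. b \<in> MA.mball a r" if a: "a \<in> measure_algebra M" and r: "r > 0" for a r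
  proof -
    obtain A0 where A0: "A0 \<in> a" "A0 \<in> sets M" using measure_algebra_representative[OF a] by blast
    \<comment> \<open>A single tolerance serves both purposes: staying in the ball around
      \<open>a\<close> and encoding \<open>B\<close>.\<close>
    have "min r e > 0" using r e by simp
    then obtain A I F where A: "A \<in> sets M" "finite I" "measure M (sym_diff A A0) < min r e"
      "measure M (sym_diff B (window_code A I F)) < min r e"
      using window_code_dense[OF A0(2) B assms(1,2,3)] by blast
    let ?b = "null_equiv M `` {A}"
    have b: "?b \<in> measure_algebra M" "A \<in> ?b"
      using A(1) null_class_in_measure_algebra mem_null_class by auto
    have "measure_algebra_dist M a ?b = measure M (sym_diff A0 A)"
      using measure_algebra_dist_class[OF a b(1) A0(1) b(2)] .
    also have "\<dots> < r" using A(3) by (simp add: Un_commute)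
    finally have "?b \<in> MA.mball a r" using a b by simp
    moreover have "?b \<in> encoding B e" using A b by (auto simp: encoding_def)
    ultimately show ?thesis by blast
  qed
  then show ?thesis unfolding measure_algebra_topology_def MA.metric_closure_of by auto
qed

end

theorem theorem6:
  fixes M :: "'a measure" and T :: "'a \<Rightarrow> 'a"
  assumes "standard_probability_space M"
    and "invertible_measure_preserving M T"
    and "aperiodic M T"
    and "ergodic M T"
    and "ks_entropy M T = 0"
  shows "generic_in (measure_algebra_topology M)
    {a \<in> measure_algebra M. \<forall>A\<in>a. generator M T {A, space M - A}}"
proof -
  interpret prob_space M using assms(1) by (simp add: standard_probability_space_def)
  interpret measure_preserving_action M "int_iterate M T"
    by (rule measure_preserving_action_int_iterate[OF prob_space_axioms assms(2)])
  interpret MA: Metric_space "measure_algebra M" "measure_algebra_dist M"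
    by (rule Metric_space_measure_algebra)
  have iterate: "int_iterate M T (int n) = T ^^ n" for n by (simp add: int_iterate_def)
  have erg: "ergodic M (int_iterate M T 1)"
    using assms(4) iterate[of 1] by simp
  have small: "\<exists>F\<in>sets M. 0 < measure M F \<and> measure M F < e" if "e > 0" for e
    using small_sets_exist[OF assms(1) measure_singleton_eq_zero[OF _ iterate assms(3)] that] .
  obtain D where D: "countable D" "D \<subseteq> sets M"
    and D_dense: "\<And>A e. A \<in> sets M \<Longrightarrow> e > 0 \<Longrightarrow> \<exists>B\<in>D. measure M (sym_diff A B) < e"
    using standard_probability_space_separable[OF assms(1)] by blast
  let ?\<G> = "\<Union>B\<in>D. range (\<lambda>k::nat. encoding B ((1/2) ^ k))"
  have cG: "countable ?\<G>" using D(1) by auto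
  \<comment> \<open>The intersection must be over a nonempty family, both to be a G-delta set and to
    lie inside \<open>measure_algebra M\<close>.\<close>
  have "D \<noteq> {}" using D_dense[of "{}" 1] by auto
  then have G_ne: "?\<G> \<noteq> {}" by simp
  have G_open: "openin (measure_algebra_topology M) W" if "W \<in> ?\<G>" for W
    using that D(2) openin_encoding by auto
  have G_dense: "measure_algebra_topology M closure_of W = measure_algebra M" if W_in: "W \<in> ?\<G>" for W
  proof -
    obtain B k where W: "W = encoding B ((1/2) ^ k)" "B \<in> D" using W_in by blast
    then have B: "B \<in> sets M" using W D(2) by blast
    show ?thesis
      unfolding W(1) by (intro closure_of_encoding erg small B eventually_block_entropy_less[OF B iterate assms(5)]) auto
  qed
  have "gdelta_in (measure_algebra_topology M) (\<Inter>?\<G>)"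
    by (intro gdelta_in_Inter cG G_ne open_imp_gdelta_in G_open)
  moreover have "measure_algebra_topology M closure_of \<Inter>?\<G> = topspace (measure_algebra_topology M)"
    using MA.metric_Baire_category[OF mcomplete_measure_algebra cG] G_open G_dense
    unfolding measure_algebra_topology_def by simp
  moreover have "\<Inter>?\<G> \<subseteq> {a \<in> measure_algebra M. \<forall>A\<in>a. generator M T {A, space M - A}}"
  proof (intro subsetI CollectI conjI ballI)
    fix a assume a: "a \<in> \<Inter>?\<G>"
    have enc: "a \<in> encoding B ((1/2) ^ k)" if "B \<in> D" for B k using a that by auto
    then show a_alg: "a \<in> measure_algebra M" using \<open>D \<noteq> {}\<close> by (auto simp: encoding_def)
    fix A assume A: "A \<in> a"
    have A_sets: "A \<in> sets M" using a_alg A by (rule measure_algebra_sets)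
    show "generator M T {A, space M - A}"
    proof (rule generator_if_window_codes_dense[OF A_sets refl])
      fix B and e :: real assume B: "B \<in> sets M" and e: "e > 0"
      \<comment> \<open>Half of \<open>e\<close> pays for replacing \<open>B\<close> by a member of
        \<open>D\<close>, half for the code of that member; passing from the representative
        \<open>A'\<close> to \<open>A\<close> is free.\<close>
      obtain B' where B': "B' \<in> D" "measure M (sym_diff B B') < e / 2"
        using D_dense[OF B, of "e / 2"] e by auto
      obtain k where k: "(1/2 :: real) ^ k < e / 2" using real_arch_pow_inv[of "e / 2" "1/2"] e by auto
      obtain A' I F where A': "A' \<in> a" "finite I" "measure M (sym_diff B' (window_code A' I F)) < (1/2) ^ k"
        using enc[OF B'(1), of k] by (auto simp: encoding_def)
      have A'_sets: "A' \<in> sets M" using a_alg A'(1) by (rule measure_algebra_sets)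
      have B'_sets: "B' \<in> sets M" using B' D by auto
      have "measure M (sym_diff A' A) = 0"
        using measure_algebra_dist_class[OF a_alg a_alg A'(1) A] a_alg by simp
      then have "measure M (sym_diff (window_code A' I F) (window_code A I F)) \<le> 0"
        using measure_sym_diff_window_code_le[OF A'_sets A_sets A'(2), of F] by simp
      moreover note measure_sym_diff_triangle[OF B B'_sets sets_window_code[OF A_sets A'(2)], of F]
        measure_sym_diff_triangle[OF B'_sets sets_window_code[OF A'_sets A'(2)]
          sets_window_code[OF A_sets A'(2)], of F F]
      ultimately have "measure M (sym_diff B (window_code A I F)) < e"
        using B'(2) A'(3) k by linarith
      then show "\<exists>I F. finite I \<and> measure M (sym_diff B (window_code A I F)) < e" using A'(2) by blast
    qed
  qed
  ultimately show ?thesis unfolding generic_in_def by blast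
qed

end
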